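(* Let $q$ be a prime power, $\alpha>2$ a real number and $\varepsilon>0$, all fixed. For each $n$ let $W=W_n$ be the noise distribution of an additive noise channel on $\mathbb{F}_q^n$ (so $W(\mathbf{y}|\mathbf{x})=W(\mathbf{y}-\mathbf{x})$), let $N\sim W$, and let $1\le k=k_n\le n$ be such that the rate $R=k/n$ satisfies $$R\ \ge\ 1-\frac{H_\alpha(W)}{n}+\varepsilon .$$ Then $$\mathbb{E}_{F\sim\mathcal{B}}\,D_\alpha\big(U_F+N\,\big\|\,U_{\mathbb{F}_q^n}\big)\longrightarrow 0\qquad\text{as } n\to\infty .$$ More specifically, as $n\to\infty$, $$\mathbb{E}_{F\sim\mathcal{B}}\,q^{(\alpha-1)D_\alpha(U_F+N\|U_{\mathbb{F}_q^n})}\ \le\ 1+O(q^{-\varepsilon n}) .$$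
   Context: Additive noise channel on $\mathbb{F}_q^n$: $W$ is a probability mass function on $\mathbb{F}_q^n$ and the channel outputs $\mathbf{y}$ on input $\mathbf{x}$ with probability $W(\mathbf{y}|\mathbf{x})=W(\mathbf{y}-\mathbf{x})$; $N$ is a random vector with distribution $W$, independent of the channel input. All logarithms are to base $q$. For $\alpha>0$, $\alpha\ne1$: the Rényi entropy is $H_\alpha(W)=\frac{1}{1-\alpha}\log\sum_{\mathbf{x}\in\mathbb{F}_q^n}W(\mathbf{x})^\alpha$, and the Rényi divergence of probability mass functions $P,Q$ on a finite set is $D_\alpha(P\|Q)=\frac{1}{\alpha-1}\log\sum_x P(x)^\alpha Q(x)^{1-\alpha}$ (random variables stand for their distributions). $\mathcal{B}$ is the set of all $[n,k]$ linear codes, i.e. $k$-dimensional subspaces of $\mathbb{F}_q^n$ (each represented by an injective linear encoder $F:\mathbb{F}_q^k\to\mathbb{F}_q^n$ whose image is the code), and $F\sim\mathcal{B}$ means that the code is chosen uniformly at random. $U_F$ is uniform over the codewords of $F$ and independent of $N$; $U_{\mathbb{F}_q^n}$ is uniform over $\mathbb{F}_q^n$. The constant implied by $O(\cdot)$ does not depend on $n$. *)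

theory Defs
  imports "HOL-Probability.Probability" "Jordan_Normal_Form.VS_Connect"
begin

text \<open>
  Random variables are represented by their distributions, of type pmf. The space \<open>F\<^sub>q\<^sup>n\<close> is
  \<open>carrier_vec n :: 'a vec set\<close> with \<open>'a :: {field, finite}\<close> and \<open>q = CARD('a)\<close>; a distribution on
  it is a \<open>'a vec pmf\<close> whose support is contained in \<open>carrier_vec n\<close>.
\<close>

text \<open>
  Entropy and divergence take the base \<open>b\<close> of the logarithm and the finite set \<open>X\<close> on which the
  distributions live. Since \<open>0 powr a = 0\<close> for every real \<open>a\<close>, the divergence below has the
  conventional value only if the support of \<open>Q\<close> contains that of \<open>P\<close> (for \<open>\<alpha> > 1\<close> it is
  conventionally infinite otherwise). This is the case for \<open>Q\<close> uniform on \<open>X\<close>.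
\<close>

definition renyi_entropy :: "real \<Rightarrow> real \<Rightarrow> 'b set \<Rightarrow> 'b pmf \<Rightarrow> real" where
  "renyi_entropy b \<alpha> X P = 1 / (1 - \<alpha>) * log b (\<Sum>x\<in>X. pmf P x powr \<alpha>)"

definition renyi_divergence :: "real \<Rightarrow> real \<Rightarrow> 'b set \<Rightarrow> 'b pmf \<Rightarrow> 'b pmf \<Rightarrow> real" where
  "renyi_divergence b \<alpha> X P Q =
     1 / (\<alpha> - 1) * log b (\<Sum>x\<in>X. pmf P x powr \<alpha> * pmf Q x powr (1 - \<alpha>))"

text \<open>The record update is the subspace \<open>C\<close> regarded as a vector space in its own right.\<close>

definition linear_codes :: "nat \<Rightarrow> nat \<Rightarrow> 'a::field vec set set" where
  "linear_codes n k =
     {C. VectorSpace.subspace class_ring C (module_vec TYPE('a) n) \<and>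
         vectorspace.dim class_ring ((module_vec TYPE('a) n)\<lparr>carrier := C\<rparr>) = k}"

text \<open>The distribution of \<open>X + Y\<close> for independent \<open>X\<close> and \<open>Y\<close> with distributions \<open>P\<close> and \<open>Q\<close>.\<close>

definition indep_sum_pmf :: "'b::plus pmf \<Rightarrow> 'b pmf \<Rightarrow> 'b pmf" where
  "indep_sum_pmf P Q = map_pmf (\<lambda>(x, y). x + y) (pair_pmf P Q)"

text \<open>\<open>D\<^sub>\<alpha>(U\<^sub>C + N || U)\<close>, logarithms to base \<open>q\<close>, where \<open>N\<close> has distribution \<open>W\<close>, \<open>U\<^sub>C\<close> is uniform
  on the code \<open>C\<close> and independent of \<open>N\<close>, and \<open>U\<close> is uniform on \<open>F\<^sub>q\<^sup>n\<close>.\<close>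

definition smoothing_divergence ::
    "real \<Rightarrow> nat \<Rightarrow> 'a::{field,finite} vec pmf \<Rightarrow> 'a vec set \<Rightarrow> real" where
  "smoothing_divergence \<alpha> n W C =
     renyi_divergence (real CARD('a)) \<alpha> (carrier_vec n)
       (indep_sum_pmf (pmf_of_set C) W) (pmf_of_set (carrier_vec n))"

end

theory Submission
  imports Defs
begin

text \<open>
  Put \<open>w = q\<^sup>n W\<close>, let \<open>g\<^sub>C\<close> be the average of \<open>w\<close> over the cosets of \<open>C\<close>, and \<open>h\<^sub>C = g\<^sub>C - 1\<close>. For the
  mean \<open>M\<close> over \<open>F\<^sub>q\<^sup>n\<close> we have \<open>q powr ((\<alpha> - 1) D) = M(g\<^sub>C\<^sup>\<alpha>)\<close> and \<open>M(h\<^sub>C) = 0\<close>, so by a Taylor bound this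
  exceeds 1 by at most a constant times \<open>M(h\<^sub>C\<^sup>2) + M(\<bar>h\<^sub>C\<bar>\<^sup>\<alpha>)\<close>. A uniform code is the span of a uniform
  linearly independent list, so it can be built one dimension at a time. Adjoining a uniform
  \<open>v \<notin> C\<close> replaces \<open>h\<close> by its average over the lines \<open>y + F\<^sub>q v\<close>, whose points are pairwise nearly
  independent. Hence the second moment drops by the factor \<open>q\<close>, and the \<open>\<alpha>\<close>-th moment drops by
  \<open>q powr (\<alpha> - 1)\<close> up to a cross term \<open>M(\<bar>h\<bar> powr (\<alpha> - 1)) M(\<bar>h\<bar>)\<close>. The latter is at most
  \<open>2 \<delta> M(\<bar>h\<bar>\<^sup>\<alpha>) + \<delta> powr (2 - \<alpha>) M(h\<^sup>2)\<close> for every \<open>\<delta> > 0\<close>; choosing \<open>\<delta> = q powr (- (k - i) / 2)\<close> in step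
  \<open>i\<close> of \<open>k\<close> makes the accumulated losses bounded. The rate hypothesis says
  \<open>M(w\<^sup>\<alpha>) \<le> Q powr (\<alpha> - 1)\<close> with \<open>Q = q powr (k - \<epsilon> n)\<close>, and both moments end up of order
  \<open>Q / q\<^sup>k = q powr (- \<epsilon> n)\<close>.
\<close>

subsection \<open>Linear codes as finite subspaces\<close>

text \<open>Coordinates with respect to a basis \<open>A\<close> put \<open>V\<close> in bijection
  with the functions from \<open>A\<close> to the scalars. A finite space has a finite basis because
  it generates itself.\<close>

lemma (in vectorspace) card_carrier_eq_power_dim:
  assumes "finite (carrier K)" and "finite (carrier V)"
  shows "card (carrier V) = card (carrier K) ^ dim"
proof -
  have "fin_dim"
    unfolding fin_dim_def using assms(2) in_own_span[OF subset_refl] span_is_subset2[OF subset_refl]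
    by (metis order_antisym subset_refl)
  then obtain A where A: "finite A" "basis A"
    using finite_basis_exists by blast
  then have AV: "A \<subseteq> carrier V" by (simp add: basis_def)
  have *: "\<exists>!a. a \<in> A \<rightarrow>\<^sub>E carrier K \<and> lincomb a A = v" if "v \<in> carrier V" for v
    using basis_criterion[OF A(1) AV] A(2) that by blast
  have cl: "lincomb a A \<in> carrier V" if "a \<in> A \<rightarrow>\<^sub>E carrier K" for a
    using that AV by (intro lincomb_closed) auto
  have "bij_betw (\<lambda>a. lincomb a A) (A \<rightarrow>\<^sub>E carrier K) (carrier V)"
    unfolding bij_betw_def inj_on_def using * cl by (auto simp: image_iff) metis+
  then have "card (carrier V) = card (A \<rightarrow>\<^sub>E carrier K)"
    by (simp add: bij_betw_same_card)
  also have "\<dots> = card (carrier K) ^ card A"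
    using A(1) by (simp add: card_PiE)
  finally show ?thesis using dim_basis[OF A] by simp
qed

lemma card_field_gt_1: "CARD('a::{field,finite}) > 1"
  using card_mono[of UNIV "{0, 1 :: 'a}"] by simp

text \<open>An elementary form of \<open>VectorSpace.subspace\<close>, free of module records, so
  that closure can be used vector by vector.\<close>

definition linear_subspace :: "nat \<Rightarrow> 'a::field vec set \<Rightarrow> bool" where
  "linear_subspace n C \<longleftrightarrow> C \<subseteq> carrier_vec n \<and> 0\<^sub>v n \<in> C \<and>
     (\<forall>x\<in>C. \<forall>y\<in>C. x + y \<in> C) \<and> (\<forall>a. \<forall>x\<in>C. a \<cdot>\<^sub>v x \<in> C)"

lemma subspace_iff_linear_subspace:
  "VectorSpace.subspace class_ring C (module_vec TYPE('a::field) n) \<longleftrightarrow> linear_subspace n C"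
proof -
  interpret vec_space "TYPE('a)" n .
  show ?thesis
    unfolding subspace_def submodule_def linear_subspace_def
    by (auto simp: module_vec_simps intro: vec_vs vec_module)
qed

lemma card_carrier_vec [simp]: "card (carrier_vec n :: 'a::{field,finite} vec set) = CARD('a) ^ n"
  and finite_carrier_vec [simp]: "finite (carrier_vec n :: 'a::{field,finite} vec set)"
proof -
  have "carrier_vec n \<subseteq> vec_of_list ` {xs :: 'a list. set xs \<subseteq> UNIV \<and> length xs = n}"
  proof
    fix v :: "'a vec" assume "v \<in> carrier_vec n"
    then have "v = vec_of_list (list_of_vec v)" "length (list_of_vec v) = n"
      by (simp_all add: vec_list)
    then show "v \<in> vec_of_list ` {xs :: 'a list. set xs \<subseteq> UNIV \<and> length xs = n}" by blast
  qed
  then show f: "finite (carrier_vec n :: 'a vec set)"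
    by (rule finite_subset) (intro finite_imageI finite_lists_length_eq finite)
  interpret vec_space "TYPE('a)" n .
  show "card (carrier_vec n :: 'a::{field,finite} vec set) = CARD('a) ^ n"
    using card_carrier_eq_power_dim f by (simp add: dim_is_n module_vec_simps class_ring_simps)
qed

lemma linear_subspace_carrier: "linear_subspace n (carrier_vec n)"
  by (auto simp: linear_subspace_def)

lemma linear_subspace_zero: "linear_subspace n {0\<^sub>v n}"
  by (auto simp: linear_subspace_def)

lemma finite_linear_subspace: "linear_subspace n (C :: 'a::{field,finite} vec set) \<Longrightarrow> finite C"
  using finite_subset[OF _ finite_carrier_vec] by (auto simp: linear_subspace_def)

text \<open>A subspace of dimension \<open>d\<close> has \<open>CARD('a) ^ d\<close> elements, and
  the exponent is determined because the base exceeds 1. From here on dimensions are handled as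
  cardinalities only.\<close>

lemma linear_codes_eq:
  "linear_codes n k = {C :: 'a::{field,finite} vec set. linear_subspace n C \<and> card C = CARD('a) ^ k}"
proof -
  have "vectorspace.dim class_ring ((module_vec TYPE('a) n)\<lparr>carrier := C\<rparr>) = k
        \<longleftrightarrow> card C = CARD('a) ^ k" if C: "linear_subspace n C" for C :: "'a vec set"
  proof -
    interpret V: vec_space "TYPE('a)" n .
    interpret W: vectorspace class_ring "(module_vec TYPE('a) n)\<lparr>carrier := C\<rparr>"
      using C V.subspace_is_vs by (simp add: subspace_iff_linear_subspace)
    have "card C = CARD('a) ^ W.dim"
      using W.card_carrier_eq_power_dim finite_linear_subspace[OF C]
      by (simp add: class_ring_simps)
    then show ?thesis using card_field_gt_1[where 'a='a] by simp
  qed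
  then show ?thesis
    by (auto simp: linear_codes_def subspace_iff_linear_subspace)
qed

text \<open>For a subspace \<open>C\<close> this is the span of \<open>C\<close> and
  \<open>v\<close>. The parametrisation is part of the definition so that sums over the span can be
  reindexed by pairs.\<close>

definition adjoin :: "'a::field vec set \<Rightarrow> 'a vec \<Rightarrow> 'a vec set" where
  "adjoin C v = (\<lambda>(c, a). c + a \<cdot>\<^sub>v v) ` (C \<times> UNIV)"

lemma linear_subspaceD:
  assumes "linear_subspace n C"
  shows "x \<in> C \<Longrightarrow> x \<in> carrier_vec n" "0\<^sub>v n \<in> C" "x \<in> C \<Longrightarrow> y \<in> C \<Longrightarrow> x + y \<in> C"
    "x \<in> C \<Longrightarrow> a \<cdot>\<^sub>v x \<in> C"
  using assms by (auto simp: linear_subspace_def)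

lemma linear_subspace_adjoin:
  assumes C: "linear_subspace n C" and v: "v \<in> carrier_vec n"
  shows "linear_subspace n (adjoin C v)"
  unfolding linear_subspace_def
proof (intro conjI ballI allI)
  show "adjoin C v \<subseteq> carrier_vec n"
    using v C by (auto simp: adjoin_def linear_subspace_def intro!: add_carrier_vec)
  have "0\<^sub>v n = 0\<^sub>v n + 0 \<cdot>\<^sub>v v" using v by (intro eq_vecI) auto
  then show "0\<^sub>v n \<in> adjoin C v"
    using linear_subspaceD(2)[OF C] unfolding adjoin_def by (intro image_eqI[where x="(0\<^sub>v n, 0)"]) auto
next
  fix x y assume "x \<in> adjoin C v" "y \<in> adjoin C v"
  then obtain c a d b where *: "c \<in> C" "d \<in> C" "x = c + a \<cdot>\<^sub>v v" "y = d + b \<cdot>\<^sub>v v"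
    by (auto simp: adjoin_def)
  have "c \<in> carrier_vec n" "d \<in> carrier_vec n"
    using * linear_subspaceD(1)[OF C] by auto
  then have "x + y = (c + d) + (a + b) \<cdot>\<^sub>v v"
    using v unfolding * by (intro eq_vecI) (auto simp: algebra_simps)
  then show "x + y \<in> adjoin C v"
    using * linear_subspaceD(3)[OF C] by (auto simp: adjoin_def)
next
  fix x b assume "x \<in> adjoin C v"
  then obtain c a where *: "c \<in> C" "x = c + a \<cdot>\<^sub>v v"
    by (auto simp: adjoin_def)
  have "c \<in> carrier_vec n"
    using * linear_subspaceD(1)[OF C] by auto
  then have "b \<cdot>\<^sub>v x = b \<cdot>\<^sub>v c + (b * a) \<cdot>\<^sub>v v"
    using v unfolding * by (intro eq_vecI) (auto simp: algebra_simps)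
  then show "b \<cdot>\<^sub>v x \<in> adjoin C v"
    using * linear_subspaceD(4)[OF C] by (auto simp: adjoin_def)
qed

text \<open>If two representations had different coefficients of \<open>v\<close>, the equation
  could be solved for \<open>v\<close> and would place it in \<open>C\<close>.\<close>

lemma inj_on_adjoin:
  assumes C: "linear_subspace n C" and v: "v \<in> carrier_vec n" "v \<notin> C"
  shows "inj_on (\<lambda>(c, a). c + a \<cdot>\<^sub>v v) (C \<times> UNIV)"
proof (rule inj_onI, clarify)
  fix c d a b assume cd: "c \<in> C" "d \<in> C" and eq: "c + a \<cdot>\<^sub>v v = d + b \<cdot>\<^sub>v v"
  have cdn: "c \<in> carrier_vec n" "d \<in> carrier_vec n"
    using cd linear_subspaceD(1)[OF C] by auto
  have idx: "vec_index c i + a * vec_index v i = vec_index d i + b * vec_index v i" if "i < n" for i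
    using arg_cong[OF eq, of "\<lambda>x. vec_index x i"] that v(1) cdn by simp
  have ab: "a = b"
  proof (rule ccontr)
    assume "a \<noteq> b"
    then have "v = (1 / (a - b)) \<cdot>\<^sub>v (d + (-1) \<cdot>\<^sub>v c)"
      using v(1) cdn idx by (intro eq_vecI) (auto simp: field_simps)
    also have "\<dots> \<in> C"
      using cd C by (intro linear_subspaceD) auto
    finally show False using v(2) by simp
  qed
  moreover have "c = d"
    using idx ab cdn by (intro eq_vecI) auto
  ultimately show "c = d \<and> a = b" by simp
qed

lemma sum_adjoin:
  fixes C :: "'a::{field,finite} vec set"
  assumes "linear_subspace n C" "v \<in> carrier_vec n" "v \<notin> C"
  shows "(\<Sum>x\<in>adjoin C v. f x) = (\<Sum>c\<in>C. \<Sum>a\<in>UNIV. f (c + a \<cdot>\<^sub>v v))"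
  unfolding adjoin_def using inj_on_adjoin[OF assms]
  by (simp add: sum.reindex sum.cartesian_product case_prod_unfold)

lemma card_adjoin:
  fixes C :: "'a::{field,finite} vec set"
  assumes "linear_subspace n C" "v \<in> carrier_vec n" "v \<notin> C"
  shows "card (adjoin C v) = card C * CARD('a)"
  unfolding adjoin_def using inj_on_adjoin[OF assms]
  by (simp add: card_image card_cartesian_product)

lemma adjoin_subset_iff:
  assumes D: "linear_subspace n D" and C: "linear_subspace n C" and v: "v \<in> carrier_vec n"
  shows "adjoin C v \<subseteq> D \<longleftrightarrow> C \<subseteq> D \<and> v \<in> D"
proof
  assume *: "adjoin C v \<subseteq> D"
  have "c = c + 0 \<cdot>\<^sub>v v" if "c \<in> C" for c
    using linear_subspaceD(1)[OF C that] v by (intro eq_vecI) auto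
  then have "C \<subseteq> adjoin C v"
    unfolding adjoin_def by (intro subsetI image_eqI[where x = "(_, 0)"]) auto
  moreover have "v = 0\<^sub>v n + 1 \<cdot>\<^sub>v v"
    using v by (intro eq_vecI) auto
  then have "v \<in> adjoin C v"
    using linear_subspaceD(2)[OF C] unfolding adjoin_def
    by (intro image_eqI[where x = "(0\<^sub>v n, 1)"]) auto
  ultimately show "C \<subseteq> D \<and> v \<in> D" using * by auto
next
  assume "C \<subseteq> D \<and> v \<in> D"
  then show "adjoin C v \<subseteq> D"
    using linear_subspaceD(3,4)[OF D] by (auto simp: adjoin_def)
qed

section \<open>Ordered bases and the uniform random code\<close>

primrec vec_span :: "nat \<Rightarrow> 'a::field vec list \<Rightarrow> 'a vec set" where
  "vec_span n [] = {0\<^sub>v n}"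
| "vec_span n (v # vs) = adjoin (vec_span n vs) v"

text \<open>These are the ordered linearly independent lists, with the newest vector at the head.
  Independence is expressed as avoiding the span of the vectors chosen earlier, which makes both
  counting and one-step averaging direct.\<close>

primrec indep_lists :: "nat \<Rightarrow> 'a::field vec set \<Rightarrow> nat \<Rightarrow> 'a vec list set" where
  "indep_lists n C 0 = {[]}"
| "indep_lists n C (Suc k) =
     (\<lambda>(vs, v). v # vs) ` (SIGMA vs:indep_lists n C k. C - vec_span n vs)"

lemma indep_listsD:
  fixes C :: "'a::{field,finite} vec set"
  assumes "linear_subspace n C" "vs \<in> indep_lists n C k"
  shows "linear_subspace n (vec_span n vs) \<and> vec_span n vs \<subseteq> C \<and> card (vec_span n vs) = CARD('a) ^ k"
  using assms(2)
proof (induction k arbitrary: vs)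
  case 0
  then show ?case using assms(1) linear_subspaceD(2) linear_subspace_zero by auto
next
  case (Suc k)
  then obtain us v where *: "us \<in> indep_lists n C k" "v \<in> C" "v \<notin> vec_span n us" "vs = v # us"
    by auto
  have "v \<in> carrier_vec n" using * assms(1) linear_subspaceD(1) by blast
  then show ?case
    using * Suc.IH[of us] assms(1) card_adjoin[of n "vec_span n us" v]
    by (simp add: linear_subspace_adjoin adjoin_subset_iff mult.commute)
qed

lemma finite_indep_lists:
  fixes C :: "'a::{field,finite} vec set"
  assumes "linear_subspace n C"
  shows "finite (indep_lists n C k)"
  by (induction k) (auto simp: finite_linear_subspace[OF assms])

lemma sum_indep_lists_Suc:
  fixes C :: "'a::{field,finite} vec set"
  assumes "linear_subspace n C"
  shows "(\<Sum>vs\<in>indep_lists n C (Suc k). F vs) =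
         (\<Sum>vs\<in>indep_lists n C k. \<Sum>v\<in>C - vec_span n vs. F (v # vs))"
proof -
  have "inj_on (\<lambda>(vs, v). v # vs) (SIGMA vs:indep_lists n C k. C - vec_span n vs)"
    by (auto simp: inj_on_def)
  then show ?thesis
    using assms
    by (simp add: sum.reindex sum.Sigma finite_indep_lists finite_linear_subspace case_prod_unfold)
qed

text \<open>Whatever the first \<open>i\<close> vectors are, their span lies in \<open>C\<close> and
  has \<open>CARD('a) ^ i\<close> elements, so the number of choices for the next vector is the same
  for every list. Beyond the dimension of \<open>C\<close> truncated subtraction gives a factor 0,
  as it should.\<close>

lemma card_indep_lists:
  fixes C :: "'a::{field,finite} vec set"
  assumes C: "linear_subspace n C"
  shows "card (indep_lists n C k) = (\<Prod>i<k. card C - CARD('a) ^ i)"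
proof (induction k)
  case (Suc k)
  have "card (indep_lists n C (Suc k)) = (\<Sum>vs\<in>indep_lists n C (Suc k). 1)" by simp
  also have "\<dots> = (\<Sum>vs\<in>indep_lists n C k. card (C - vec_span n vs))"
    by (subst sum_indep_lists_Suc[OF C]) simp
  also have "\<dots> = (\<Sum>vs\<in>indep_lists n C k. card C - CARD('a) ^ k)"
  proof (intro sum.cong refl)
    fix vs assume "vs \<in> indep_lists n C k"
    from indep_listsD[OF C this] show "card (C - vec_span n vs) = card C - CARD('a) ^ k"
      using card_Diff_subset[of "vec_span n vs" C] finite_linear_subspace[of n "vec_span n vs"] by simp
  qed
  finally show ?case by (simp add: Suc)
qed simp

text \<open>Independence does not refer to the ambient space, so only membership in \<open>C\<close>
  has to be compared. This identifies the lists that span a given code.\<close>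

lemma indep_lists_subspace_iff:
  fixes C :: "'a::{field,finite} vec set"
  assumes C: "linear_subspace n C"
  shows "vs \<in> indep_lists n C k \<longleftrightarrow> vs \<in> indep_lists n (carrier_vec n) k \<and> vec_span n vs \<subseteq> C"
proof (induction k arbitrary: vs)
  case 0
  then show ?case using linear_subspaceD(2)[OF C] by auto
next
  case (Suc k)
  have *: "C \<subseteq> carrier_vec n" using C by (simp add: linear_subspace_def)
  show ?case
  proof (cases vs)
    case (Cons v us)
    have "adjoin (vec_span n us) v \<subseteq> C \<longleftrightarrow> vec_span n us \<subseteq> C \<and> v \<in> C"
      if "us \<in> indep_lists n (carrier_vec n) k" "v \<in> carrier_vec n"
      using that adjoin_subset_iff[OF C] indep_listsD[OF linear_subspace_carrier] by blast
    then show ?thesis using Suc.IH[of us] Cons * by auto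
  qed auto
qed

lemma finite_linear_codes: "finite (linear_codes n k :: 'a::{field,finite} vec set set)"
  by (rule finite_subset[of _ "Pow (carrier_vec n)"]) (auto simp: linear_codes_eq linear_subspace_def)

text \<open>Group the lists by their span. All codes of dimension \<open>k\<close> have the same
  number of ordered bases, and this number is the product in front.\<close>

lemma sum_indep_lists_carrier:
  fixes F :: "'a::{field,finite} vec set \<Rightarrow> real"
  shows "(\<Sum>vs\<in>indep_lists n (carrier_vec n) k. F (vec_span n vs)) =
    (\<Prod>i<k. CARD('a) ^ k - CARD('a) ^ i) * (\<Sum>C\<in>linear_codes n k. F C)"
proof -
  let ?L = "indep_lists n (carrier_vec n :: 'a vec set) k"
  note V = linear_subspace_carrier[of n, where 'a='a]
  have "vec_span n ` ?L \<subseteq> linear_codes n k"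
    using indep_listsD[OF V] by (auto simp: linear_codes_eq)
  then have "(\<Sum>vs\<in>?L. F (vec_span n vs)) =
      (\<Sum>C\<in>linear_codes n k. \<Sum>vs\<in>{vs\<in>?L. vec_span n vs = C}. F (vec_span n vs))"
    using finite_linear_codes finite_indep_lists[OF V] by (intro sum.group[symmetric]) auto
  also have "\<dots> = (\<Sum>C\<in>linear_codes n k. (\<Prod>i<k. CARD('a) ^ k - CARD('a) ^ i) * F C)"
  proof (rule sum.cong)
    fix C :: "'a vec set" assume "C \<in> linear_codes n k"
    then have C: "linear_subspace n C" "card C = CARD('a) ^ k" by (auto simp: linear_codes_eq)
    \<comment> \<open>Both sets have \<open>CARD('a) ^ k\<close> elements, so inclusion already
      forces equality.\<close>
    have "vec_span n vs = C \<longleftrightarrow> vec_span n vs \<subseteq> C" if "vs \<in> ?L" for vs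
      using card_subset_eq[OF finite_linear_subspace[OF C(1)]] C(2) indep_listsD[OF V that] by auto
    then have "{vs\<in>?L. vec_span n vs = C} = indep_lists n C k"
      using indep_lists_subspace_iff[OF C(1)] by blast
    moreover have "(\<Sum>vs\<in>{vs\<in>?L. vec_span n vs = C}. F (vec_span n vs)) =
        (\<Sum>vs\<in>{vs\<in>?L. vec_span n vs = C}. F C)"
      by (rule sum.cong) auto
    ultimately show "(\<Sum>vs\<in>{vs\<in>?L. vec_span n vs = C}. F (vec_span n vs)) =
        (\<Prod>i<k. CARD('a) ^ k - CARD('a) ^ i) * F C"
      using card_indep_lists[OF C(1), of k] C(2) by simp
  qed simp
  finally show ?thesis by (simp add: sum_distrib_left)
qed

lemma card_indep_lists_pos:
  assumes "k \<le> n"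
  shows "card (indep_lists n (carrier_vec n :: 'a::{field,finite} vec set) k) > 0"
proof -
  have "CARD('a) ^ i < CARD('a) ^ n" if "i < k" for i
    using that assms card_field_gt_1[where 'a='a] by (intro power_strict_increasing) auto
  then show ?thesis
    by (auto simp: card_indep_lists[OF linear_subspace_carrier] intro!: prod_pos)
qed

lemma linear_codes_nonempty:
  assumes "k \<le> n"
  shows "(linear_codes n k :: 'a::{field,finite} vec set set) \<noteq> {}"
proof -
  obtain vs :: "'a vec list" where "vs \<in> indep_lists n (carrier_vec n) k"
    using card_indep_lists_pos[OF assms, where 'a='a] by (metis card_gt_0_iff equals0I)
  then show ?thesis
    using indep_listsD[OF linear_subspace_carrier] by (auto simp: linear_codes_eq)
qed

text \<open>The common number of ordered bases cancels between the sum and the count: a uniform code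
  is distributed as the span of a uniform independent list.\<close>

lemma expectation_linear_codes:
  fixes F :: "'a::{field,finite} vec set \<Rightarrow> real"
  assumes "k \<le> n"
  shows "measure_pmf.expectation (pmf_of_set (linear_codes n k)) F =
    (\<Sum>vs\<in>indep_lists n (carrier_vec n) k. F (vec_span n vs)) /
      card (indep_lists n (carrier_vec n :: 'a vec set) k)"
proof -
  let ?L = "indep_lists n (carrier_vec n :: 'a vec set) k"
  define N where "N = real (\<Prod>i<k. CARD('a) ^ k - CARD('a) ^ i)"
  have L: "real (card ?L) = N * card (linear_codes n k :: 'a vec set set)"
    using sum_indep_lists_carrier[of "\<lambda>_ :: 'a vec set. 1" n k] by (simp add: N_def)
  have "N \<noteq> 0"
    using L card_indep_lists_pos[OF assms, where 'a='a] by fastforce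
  moreover have "(\<Sum>vs\<in>?L. F (vec_span n vs)) = N * (\<Sum>C\<in>linear_codes n k. F C)"
    by (simp only: sum_indep_lists_carrier N_def)
  moreover have "measure_pmf.expectation (pmf_of_set (linear_codes n k)) F =
      (\<Sum>C\<in>linear_codes n k. F C) / card (linear_codes n k :: 'a vec set set)"
    by (intro integral_pmf_of_set finite_linear_codes linear_codes_nonempty[OF assms])
  ultimately show ?thesis by (simp add: L)
qed

subsection \<open>Real inequalities\<close>

text \<open>A convex function lies above its tangent at \<open>c\<close>. After division by
  \<open>c powr p\<close> this is Bernoulli's inequality for \<open>x / c\<close>, which follows
  from Young's inequality with second factor 1.\<close>

lemma powr_tangent:
  fixes x c p :: real
  assumes "x \<ge> 0" "c \<ge> 0" "p \<ge> 1"
  shows "c powr p + p * c powr (p - 1) * (x - c) \<le> x powr p"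
proof (cases "c = 0 \<or> x = 0")
  case True
  have "c powr p = c * c powr (p - 1)"
    using assms by (cases "c = 0") (simp_all add: powr_diff)
  then have "c powr p + p * c powr (p - 1) * (0 - c) = (1 - p) * c powr p"
    by (simp add: algebra_simps)
  also have "\<dots> \<le> 0" using assms by (intro mult_nonpos_nonneg) auto
  finally show ?thesis using True by auto
next
  case False
  then have pos: "c > 0" "x > 0" using assms by auto
  let ?t = "x / c"
  have "(?t powr p) powr (1 / p) * 1 powr (1 - 1 / p) \<le> 1 / p * ?t powr p + (1 - 1 / p) * 1"
    using pos assms by (intro Youngs_inequality_0) auto
  then have "?t \<le> 1 / p * ?t powr p + (1 - 1 / p)"
    using pos assms by (simp add: powr_powr)
  then have "p * ?t \<le> p * (1 / p * ?t powr p + (1 - 1 / p))"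
    using assms by (intro mult_left_mono) auto
  then have "1 + p * (?t - 1) \<le> ?t powr p"
    using assms by (simp add: distrib_left right_diff_distrib)
  then have "c powr p * (1 + p * (?t - 1)) \<le> c powr p * ?t powr p"
    by (intro mult_left_mono) auto
  also have "c powr p * ?t powr p = x powr p"
    using pos by (simp add: powr_divide)
  also have "c powr p * (1 + p * (?t - 1)) = c powr p + p * (c powr p / c) * (x - c)"
    using pos by (simp add: field_simps)
  also have "c powr p / c = c powr (p - 1)"
    using pos by (simp add: powr_diff)
  finally show ?thesis .
qed

text \<open>Let \<open>a m\<close> be the largest entry and \<open>S\<close> the sum. The tangent at
  \<open>S\<close>, evaluated at \<open>a m\<close>, gives \<open>S powr \<alpha> \<le> a m powr
  \<alpha> + \<alpha> * S powr (\<alpha> - 1) * (S - a m)\<close>, and \<open>S\<close> is at most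
  \<open>card A * a m\<close>. The point of this form is that the diagonal terms keep the constant
  1; only products of different entries pay a larger one.\<close>

lemma sum_powr_le:
  fixes a :: "'i \<Rightarrow> real"
  assumes fin: "finite A" and nn: "\<And>i. i \<in> A \<Longrightarrow> a i \<ge> 0" and "\<alpha> \<ge> 1"
  shows "(\<Sum>i\<in>A. a i) powr \<alpha> \<le> (\<Sum>i\<in>A. a i powr \<alpha>) +
    \<alpha> * real (card A) powr (\<alpha> - 1) * (\<Sum>i\<in>A. \<Sum>j\<in>A - {i}. a i powr (\<alpha> - 1) * a j)"
proof (cases "A = {}")
  case False
  have "Max (a ` A) \<in> a ` A" using fin False by (intro Max_in) auto
  then obtain m where "m \<in> A" "Max (a ` A) = a m" by auto
  then have m: "m \<in> A" "\<And>i. i \<in> A \<Longrightarrow> a i \<le> a m"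
    using Max_ge[of "a ` A"] fin by auto
  let ?S = "\<Sum>i\<in>A. a i"
  have S: "?S = a m + (\<Sum>j\<in>A - {m}. a j)" using fin m(1) by (simp add: sum.remove)
  have Snn: "?S \<ge> 0" using nn by (intro sum_nonneg) auto
  have Rnn: "(\<Sum>j\<in>A - {m}. a j) \<ge> 0" using nn by (intro sum_nonneg) auto
  have le: "?S \<le> card A * a m" using sum_bounded_above[of A a "a m"] m(2) by simp
  have "?S powr (\<alpha> - 1) \<le> (card A * a m) powr (\<alpha> - 1)"
    using Snn le assms by (intro powr_mono2) auto
  also have "\<dots> = real (card A) powr (\<alpha> - 1) * a m powr (\<alpha> - 1)"
    using nn[OF m(1)] by (simp add: powr_mult)
  finally have 1: "?S powr (\<alpha> - 1) \<le> real (card A) powr (\<alpha> - 1) * a m powr (\<alpha> - 1)" .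
  have "?S powr \<alpha> \<le> a m powr \<alpha> + \<alpha> * ?S powr (\<alpha> - 1) * (\<Sum>j\<in>A - {m}. a j)"
    using powr_tangent[OF nn[OF m(1)] Snn assms(3)] S by (simp add: algebra_simps)
  also have "\<dots> \<le> a m powr \<alpha> +
      \<alpha> * (real (card A) powr (\<alpha> - 1) * a m powr (\<alpha> - 1)) * (\<Sum>j\<in>A - {m}. a j)"
    using 1 Rnn assms by (intro add_left_mono mult_right_mono mult_left_mono) auto
  also have "\<dots> = a m powr \<alpha> +
      \<alpha> * real (card A) powr (\<alpha> - 1) * (\<Sum>j\<in>A - {m}. a m powr (\<alpha> - 1) * a j)"
    by (simp add: sum_distrib_left[symmetric])
  also have "\<dots> \<le> (\<Sum>i\<in>A. a i powr \<alpha>) +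
      \<alpha> * real (card A) powr (\<alpha> - 1) * (\<Sum>i\<in>A. \<Sum>j\<in>A - {i}. a i powr (\<alpha> - 1) * a j)"
    using fin m(1) nn assms
    by (intro add_mono mult_left_mono member_le_sum sum_nonneg mult_nonneg_nonneg
        member_le_sum[where f = "\<lambda>i. \<Sum>j\<in>A - {i}. a i powr (\<alpha> - 1) * a j"]) auto
  finally show ?thesis .
qed (use assms in auto)

text \<open>If \<open>\<delta> * t \<ge> 1\<close>, the first summand alone suffices; otherwise
  \<open>t powr (\<alpha> - 2)\<close> is at most \<open>\<delta> powr (2 - \<alpha>)\<close> and
  the second one does.\<close>

lemma powr_le_interpolate:
  fixes t \<delta> \<alpha> :: real
  assumes "t \<ge> 0" "\<delta> > 0" "\<alpha> \<ge> 2"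
  shows "t powr (\<alpha> - 1) \<le> \<delta> * t powr \<alpha> + \<delta> powr (2 - \<alpha>) * t"
proof (cases "t = 0")
  case False
  then have t: "t > 0" using assms by simp
  show ?thesis
  proof (cases "\<delta> * t \<ge> 1")
    case True
    have "1 * t powr (\<alpha> - 1) \<le> (\<delta> * t) * t powr (\<alpha> - 1)"
      using True by (intro mult_right_mono) auto
    also have "\<dots> = \<delta> * t powr \<alpha>"
      using t by (simp add: powr_diff)
    finally show ?thesis using t by (simp add: add_increasing2)
  next
    case False
    then have "t \<le> 1 / \<delta>" using assms by (simp add: field_simps)
    then have "t powr (\<alpha> - 2) \<le> (1 / \<delta>) powr (\<alpha> - 2)"
      using t assms by (intro powr_mono2) auto
    also have "\<dots> = \<delta> powr (2 - \<alpha>)"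
      using assms by (simp add: powr_divide powr_diff)
    finally have "t powr (\<alpha> - 2) * t \<le> \<delta> powr (2 - \<alpha>) * t"
      using t by (intro mult_right_mono) auto
    moreover have "t powr (\<alpha> - 2) * t = t powr (\<alpha> - 1)"
      using t by (simp add: powr_diff power2_eq_square)
    ultimately show ?thesis using assms by (simp add: add_increasing)
  qed
qed (use assms in auto)

text \<open>Near 1 the remainder after the linear term is quadratic; for \<open>t > 2\<close> one
  has \<open>t \<le> 2 * \<bar>t - 1\<bar>\<close>, and the power term takes over. The linear term
  is kept exact because it vanishes on averaging.\<close>

lemma powr_le_taylor:
  fixes t \<alpha> :: real
  assumes t: "t \<ge> 0" and \<alpha>: "\<alpha> \<ge> 2"
  shows "t powr \<alpha> \<le> 1 + \<alpha> * (t - 1) +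
    \<alpha> * (\<alpha> - 1) * 2 powr \<alpha> * ((t - 1)\<^sup>2 + \<bar>t - 1\<bar> powr \<alpha>)"
proof (cases "t \<le> 2")
  case True
  \<comment> \<open>The increment of \<open>t powr (\<alpha> - 1)\<close> from 1 is linear in
    \<open>t - 1\<close>, by the tangent at the larger of \<open>t\<close> and 1; on this range its
    slope is at most \<open>(\<alpha> - 1) * 2 powr \<alpha>\<close>.\<close>
  have *: "(t powr (\<alpha> - 1) - 1) * (t - 1) \<le> (\<alpha> - 1) * 2 powr \<alpha> * (t - 1)\<^sup>2"
  proof (cases "t \<ge> 1")
    case t1: True
    have "t powr (\<alpha> - 1) - 1 \<le> (\<alpha> - 1) * t powr (\<alpha> - 2) * (t - 1)"
      using powr_tangent[of 1 t "\<alpha> - 1"] assms by (simp add: algebra_simps)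
    also have "t powr (\<alpha> - 2) \<le> 2 powr (\<alpha> - 2)"
      using assms True by (intro powr_mono2) auto
    also have "\<dots> \<le> 2 powr \<alpha>" by simp
    finally have "t powr (\<alpha> - 1) - 1 \<le> (\<alpha> - 1) * 2 powr \<alpha> * (t - 1)"
      using assms t1 by (simp add: mult_left_mono mult_right_mono)
    then have "(t powr (\<alpha> - 1) - 1) * (t - 1) \<le> (\<alpha> - 1) * 2 powr \<alpha> * (t - 1) * (t - 1)"
      using t1 by (intro mult_right_mono) auto
    then show ?thesis by (simp add: power2_eq_square mult_ac)
  next
    case t1: False
    have "1 - t powr (\<alpha> - 1) \<le> (\<alpha> - 1) * (1 - t)"
      using powr_tangent[of t 1 "\<alpha> - 1"] assms by (simp add: algebra_simps)
    also have "\<dots> \<le> (\<alpha> - 1) * 2 powr \<alpha> * (1 - t)"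
      using t1 assms ge_one_powr_ge_zero[of 2 \<alpha>] by (intro mult_right_mono) auto
    finally have "(1 - t powr (\<alpha> - 1)) * (1 - t) \<le> (\<alpha> - 1) * 2 powr \<alpha> * (1 - t) * (1 - t)"
      using t1 by (intro mult_right_mono) auto
    then show ?thesis by (simp add: power2_eq_square algebra_simps)
  qed
  have "t powr \<alpha> \<le> 1 + \<alpha> * t powr (\<alpha> - 1) * (t - 1)"
    using powr_tangent[of 1 t \<alpha>] assms by (simp add: algebra_simps)
  also have "\<dots> = 1 + \<alpha> * (t - 1) + \<alpha> * ((t powr (\<alpha> - 1) - 1) * (t - 1))"
    by (simp add: algebra_simps)
  also have "\<dots> \<le> 1 + \<alpha> * (t - 1) + \<alpha> * ((\<alpha> - 1) * 2 powr \<alpha> * (t - 1)\<^sup>2)"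
    using * assms by (intro add_left_mono mult_left_mono) auto
  also have "\<dots> \<le> 1 + \<alpha> * (t - 1) +
      \<alpha> * ((\<alpha> - 1) * 2 powr \<alpha> * ((t - 1)\<^sup>2 + \<bar>t - 1\<bar> powr \<alpha>))"
    using assms by (intro add_left_mono mult_left_mono) auto
  finally show ?thesis by (simp add: mult_ac)
next
  case False
  have "1 * 1 \<le> \<alpha> * (\<alpha> - 1)" using \<alpha> by (intro mult_mono) auto
  then have 1: "1 \<le> \<alpha> * (\<alpha> - 1)" by simp
  have "t powr \<alpha> \<le> (2 * \<bar>t - 1\<bar>) powr \<alpha>"
    using False assms by (intro powr_mono2) auto
  also have "\<dots> = 1 * (2 powr \<alpha> * \<bar>t - 1\<bar> powr \<alpha>)" by (simp add: powr_mult)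
  also have "\<dots> \<le> \<alpha> * (\<alpha> - 1) * (2 powr \<alpha> * \<bar>t - 1\<bar> powr \<alpha>)"
    using 1 by (intro mult_right_mono) auto
  also have "\<dots> \<le> \<alpha> * (\<alpha> - 1) * (2 powr \<alpha> * ((t - 1)\<^sup>2 + \<bar>t - 1\<bar> powr \<alpha>))"
    using 1 by (intro mult_left_mono) auto
  also have "\<dots> \<le> 1 + \<alpha> * (t - 1) + \<alpha> * (\<alpha> - 1) * (2 powr \<alpha> * ((t - 1)\<^sup>2 + \<bar>t - 1\<bar> powr \<alpha>))"
    using False assms by simp
  finally show ?thesis by (simp add: mult_ac)
qed

text \<open>Reversing the index gives a geometric series with exponents from 1 to \<open>k\<close>.
  The bound is uniform in \<open>k\<close>, which keeps losses accumulated over all steps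
  bounded.\<close>

lemma sum_power_diff_le:
  fixes x :: real
  assumes "0 \<le> x" "x < 1"
  shows "(\<Sum>i<k. x ^ (k - i)) \<le> 1 / (1 - x)"
proof -
  have "(\<Sum>i<k. x ^ (k - i)) = (\<Sum>i<k. x ^ Suc i)"
    by (rule sum.reindex_bij_witness[of _ "\<lambda>i. k - Suc i" "\<lambda>i. k - Suc i"]) (auto simp: Suc_diff_Suc)
  also have "\<dots> \<le> (\<Sum>i<k. x ^ i)"
    using assms by (intro sum_mono power_decreasing) auto
  also have "\<dots> = (1 - x ^ k) / (1 - x)"
    using assms by (simp add: sum_gp_strict)
  also have "\<dots> \<le> 1 / (1 - x)"
    using assms by (intro divide_right_mono) auto
  finally show ?thesis .
qed

text \<open>Each factor \<open>1 + d i\<close> is at most \<open>exp (d i)\<close>, so the growth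
  factors multiply to the exponential of the sum. Every error term is charged the full
  product.\<close>

lemma discrete_gronwall:
  fixes u d e :: "nat \<Rightarrow> real"
  assumes step: "\<And>i. i < k \<Longrightarrow> u (Suc i) \<le> (1 + d i) * u i + e i"
    and u: "u 0 \<ge> 0" and d: "\<And>i. d i \<ge> 0" and e: "\<And>i. e i \<ge> 0"
  shows "u k \<le> exp (\<Sum>i<k. d i) * (u 0 + (\<Sum>i<k. e i))"
  using step
proof (induction k)
  case (Suc k)
  let ?B = "u 0 + (\<Sum>i<k. e i)"
  have B: "?B \<ge> 0" using u e by (simp add: sum_nonneg)
  have "u (Suc k) \<le> (1 + d k) * u k + e k" using Suc.prems by simp
  also have "\<dots> \<le> exp (d k) * (exp (\<Sum>i<k. d i) * ?B) + exp (\<Sum>i<Suc k. d i) * e k"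
  proof (rule add_mono)
    have "(1 + d k) * u k \<le> (1 + d k) * (exp (\<Sum>i<k. d i) * ?B)"
      using Suc d[of k] by (intro mult_left_mono) auto
    also have "\<dots> \<le> exp (d k) * (exp (\<Sum>i<k. d i) * ?B)"
      using B by (intro mult_right_mono exp_ge_add_one_self) auto
    finally show "(1 + d k) * u k \<le> exp (d k) * (exp (\<Sum>i<k. d i) * ?B)" .
    have "1 * e k \<le> exp (\<Sum>i<Suc k. d i) * e k"
      using e d by (intro mult_right_mono) (auto intro!: sum_nonneg add_nonneg_nonneg)
    then show "e k \<le> exp (\<Sum>i<Suc k. d i) * e k" by simp
  qed
  also have "\<dots> = exp (\<Sum>i<Suc k. d i) * (u 0 + (\<Sum>i<Suc k. e i))"
    by (simp add: exp_add algebra_simps)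
  finally show ?case .
qed (use u in simp)

subsection \<open>Averages over lines and cosets\<close>

definition line_avg :: "'a::{field,finite} vec \<Rightarrow> ('a vec \<Rightarrow> real) \<Rightarrow> 'a vec \<Rightarrow> real" where
  "line_avg v f y = (\<Sum>a\<in>UNIV. f (y + a \<cdot>\<^sub>v v)) / real CARD('a)"

definition coset_avg :: "'a::{field,finite} vec set \<Rightarrow> ('a vec \<Rightarrow> real) \<Rightarrow> 'a vec \<Rightarrow> real" where
  "coset_avg C f y = (\<Sum>c\<in>C. f (y + c)) / real (card C)"

definition vec_mean :: "nat \<Rightarrow> ('a::{field,finite} vec \<Rightarrow> real) \<Rightarrow> real" where
  "vec_mean n f = (\<Sum>y\<in>carrier_vec n. f y) / real (CARD('a) ^ n)"

lemma vec_mean_mono: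
  assumes "\<And>y. y \<in> carrier_vec n \<Longrightarrow> f y \<le> g y"
  shows "vec_mean n f \<le> vec_mean n g"
  unfolding vec_mean_def using assms by (intro divide_right_mono sum_mono) auto

lemma vec_mean_cong:
  assumes "\<And>y. y \<in> carrier_vec n \<Longrightarrow> f y = g y"
  shows "vec_mean n f = vec_mean n g"
  unfolding vec_mean_def using assms by (simp cong: sum.cong)

lemma vec_mean_nonneg:
  assumes "\<And>y. y \<in> carrier_vec n \<Longrightarrow> 0 \<le> f y"
  shows "0 \<le> vec_mean n f"
  unfolding vec_mean_def using assms by (intro divide_nonneg_nonneg sum_nonneg) auto

lemma vec_mean_add: "vec_mean n (\<lambda>y. f y + g y) = vec_mean n f + vec_mean n g"
  by (simp add: vec_mean_def sum.distrib add_divide_distrib)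

lemma vec_mean_diff: "vec_mean n (\<lambda>y. f y - g y) = vec_mean n f - vec_mean n g"
  by (simp add: vec_mean_def sum_subtractf diff_divide_distrib)

lemma vec_mean_cmult: "vec_mean n (\<lambda>y. c * f y) = c * vec_mean n f"
  by (simp add: vec_mean_def sum_distrib_left)

lemma vec_mean_const: "vec_mean n (\<lambda>y :: 'a::{field,finite} vec. c) = c"
  by (simp add: vec_mean_def)

text \<open>The variance of \<open>f\<close> is nonnegative.\<close>

lemma vec_mean_power2_le: "(vec_mean n f)\<^sup>2 \<le> vec_mean n (\<lambda>y. (f y)\<^sup>2)"
proof -
  have "0 \<le> vec_mean n (\<lambda>y. (f y - vec_mean n f)\<^sup>2)"
    by (intro vec_mean_nonneg) auto
  also have "\<dots> = vec_mean n (\<lambda>y. ((f y)\<^sup>2 + (vec_mean n f)\<^sup>2) - 2 * vec_mean n f * f y)"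
    by (simp add: power2_diff mult_ac)
  also have "\<dots> = vec_mean n (\<lambda>y. (f y)\<^sup>2) - (vec_mean n f)\<^sup>2"
    by (simp add: vec_mean_add vec_mean_diff vec_mean_cmult vec_mean_const)
      (simp add: power2_eq_square)
  finally show ?thesis by simp
qed

lemma sum_carrier_vec_translate:
  fixes f :: "'a::{field,finite} vec \<Rightarrow> real"
  assumes v: "v \<in> carrier_vec n"
  shows "(\<Sum>y\<in>carrier_vec n. f (y + v)) = (\<Sum>y\<in>carrier_vec n. f y)"
proof (rule sum.reindex_bij_witness[of _ "\<lambda>y. y - v" "\<lambda>y. y + v"])
  fix y :: "'a vec" assume y: "y \<in> carrier_vec n"
  show "y + v - v = y" using y v by (intro eq_vecI) auto
  show "y - v + v = y" using y v by (intro eq_vecI) auto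
  show "y + v \<in> carrier_vec n" using y v by (rule add_carrier_vec)
  show "y - v \<in> carrier_vec n" using y v by (rule minus_carrier_vec)
qed simp

lemma sum_carrier_vec_scale:
  fixes f :: "'a::{field,finite} vec \<Rightarrow> real"
  assumes k: "k \<noteq> 0"
  shows "(\<Sum>y\<in>carrier_vec n. f (k \<cdot>\<^sub>v y)) = (\<Sum>y\<in>carrier_vec n. f y)"
proof (rule sum.reindex_bij_witness[of _ "\<lambda>y. (1 / k) \<cdot>\<^sub>v y" "\<lambda>y. k \<cdot>\<^sub>v y"])
  fix y :: "'a vec" assume y: "y \<in> carrier_vec n"
  show "(1 / k) \<cdot>\<^sub>v (k \<cdot>\<^sub>v y) = y" using y k by (intro eq_vecI) auto
  show "k \<cdot>\<^sub>v ((1 / k) \<cdot>\<^sub>v y) = y" using y k by (intro eq_vecI) auto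
  show "k \<cdot>\<^sub>v y \<in> carrier_vec n" using y by (rule smult_carrier_vec[THEN iffD2])
  show "(1 / k) \<cdot>\<^sub>v y \<in> carrier_vec n" using y by (rule smult_carrier_vec[THEN iffD2])
qed simp

text \<open>For independent uniform \<open>y\<close> and \<open>v\<close>, two different points of
  the line through \<open>y\<close> in direction \<open>v\<close> are independent and uniform.
  Translating \<open>y\<close> removes \<open>a\<close>, and the nonzero factor \<open>b - a\<close>
  is then removed by rescaling \<open>v\<close>.\<close>

lemma sum_carrier_vec_pair:
  fixes f g :: "'a::{field,finite} vec \<Rightarrow> real"
  assumes "a \<noteq> b"
  shows "(\<Sum>v\<in>carrier_vec n. \<Sum>y\<in>carrier_vec n. f (y + a \<cdot>\<^sub>v v) * g (y + b \<cdot>\<^sub>v v)) =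
    (\<Sum>y\<in>carrier_vec n. f y) * (\<Sum>y\<in>carrier_vec n. g y)"
proof -
  let ?V = "carrier_vec n :: 'a vec set"
  have "(\<Sum>v\<in>?V. \<Sum>y\<in>?V. f (y + a \<cdot>\<^sub>v v) * g (y + b \<cdot>\<^sub>v v)) =
      (\<Sum>v\<in>?V. \<Sum>y\<in>?V. f y * g (y + (b - a) \<cdot>\<^sub>v v))"
  proof (rule sum.cong)
    fix v :: "'a vec" assume v: "v \<in> ?V"
    have "(\<Sum>y\<in>?V. f (y + a \<cdot>\<^sub>v v) * g (y + b \<cdot>\<^sub>v v)) =
        (\<Sum>y\<in>?V. f (y + a \<cdot>\<^sub>v v) * g ((y + a \<cdot>\<^sub>v v) + (b - a) \<cdot>\<^sub>v v))"
    proof (rule sum.cong)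
      fix y :: "'a vec" assume y: "y \<in> ?V"
      have "y + b \<cdot>\<^sub>v v = (y + a \<cdot>\<^sub>v v) + (b - a) \<cdot>\<^sub>v v"
        using y v by (intro eq_vecI) (auto simp: algebra_simps)
      then show "f (y + a \<cdot>\<^sub>v v) * g (y + b \<cdot>\<^sub>v v) =
          f (y + a \<cdot>\<^sub>v v) * g ((y + a \<cdot>\<^sub>v v) + (b - a) \<cdot>\<^sub>v v)" by simp
    qed simp
    also have "\<dots> = (\<Sum>y\<in>?V. f y * g (y + (b - a) \<cdot>\<^sub>v v))"
      by (rule sum_carrier_vec_translate[of "a \<cdot>\<^sub>v v" n "\<lambda>y. f y * g (y + (b - a) \<cdot>\<^sub>v v)"])
        (use v in simp)
    finally show "(\<Sum>y\<in>?V. f (y + a \<cdot>\<^sub>v v) * g (y + b \<cdot>\<^sub>v v)) =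
        (\<Sum>y\<in>?V. f y * g (y + (b - a) \<cdot>\<^sub>v v))" .
  qed simp
  also have "\<dots> = (\<Sum>y\<in>?V. f y * (\<Sum>v\<in>?V. g (y + (b - a) \<cdot>\<^sub>v v)))"
    by (subst sum.swap) (simp add: sum_distrib_left)
  also have "\<dots> = (\<Sum>y\<in>?V. f y * (\<Sum>v\<in>?V. g v))"
  proof (rule sum.cong)
    fix y :: "'a vec" assume y: "y \<in> ?V"
    have "(\<Sum>v\<in>?V. g (y + (b - a) \<cdot>\<^sub>v v)) = (\<Sum>v\<in>?V. g (y + v))"
      using assms by (intro sum_carrier_vec_scale[of _ "\<lambda>v. g (y + v)"]) simp
    also have "\<dots> = (\<Sum>v\<in>?V. g (v + y))"
      using y by (intro sum.cong refl arg_cong[of _ _ g] comm_add_vec) auto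
    also have "\<dots> = (\<Sum>v\<in>?V. g v)"
      using y by (rule sum_carrier_vec_translate)
    finally show "f y * (\<Sum>v\<in>?V. g (y + (b - a) \<cdot>\<^sub>v v)) = f y * (\<Sum>v\<in>?V. g v)" by simp
  qed simp
  finally show ?thesis by (simp add: sum_distrib_right)
qed

text \<open>Expand the square into pairs of points on the line. The \<open>q\<close> diagonal pairs
  each give a full second moment, the other pairs contribute at most 0 in total, and division by the
  square of \<open>q\<close> leaves the factor \<open>1 / q\<close>.\<close>

lemma sum_line_avg_power2_le:
  fixes h :: "'a::{field,finite} vec \<Rightarrow> real"
  assumes C: "linear_subspace n C"
    and inv: "\<And>c y. c \<in> C \<Longrightarrow> y \<in> carrier_vec n \<Longrightarrow> h (y + c) = h y"
    and zero: "vec_mean n h = 0"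
  shows "(\<Sum>v\<in>carrier_vec n - C. vec_mean n (\<lambda>y. (line_avg v h y)\<^sup>2)) \<le>
    card (carrier_vec n - C) * (vec_mean n (\<lambda>y. (h y)\<^sup>2) / CARD('a))"
proof -
  let ?V = "carrier_vec n :: 'a vec set"
  let ?q = "real CARD('a)"
  let ?H = "\<Sum>y\<in>?V. (h y)\<^sup>2"
  let ?X = "\<lambda>a b v. \<Sum>y\<in>?V. h (y + a \<cdot>\<^sub>v v) * h (y + b \<cdot>\<^sub>v v)"
  have CV: "C \<subseteq> ?V" using C by (simp add: linear_subspace_def)
  have diag: "?X a a v = ?H" if "v \<in> ?V" for a v
    using sum_carrier_vec_translate[of "a \<cdot>\<^sub>v v" n "\<lambda>y. (h y)\<^sup>2"] that by (simp add: power2_eq_square)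
  \<comment> \<open>Over all \<open>v\<close> the two points are independent; the omitted part \<open>v \<in> C\<close> is nonnegative by invariance.\<close>
  have off: "(\<Sum>v\<in>?V - C. ?X a b v) \<le> 0" if "a \<noteq> b" for a b
  proof -
    have "(\<Sum>v\<in>?V. ?X a b v) = 0"
      using sum_carrier_vec_pair[OF that, of h h n] zero by (simp add: vec_mean_def)
    moreover have "(\<Sum>v\<in>C. ?X a b v) \<ge> 0"
    proof (intro sum_nonneg)
      fix v y assume "v \<in> C" "y \<in> ?V"
      then show "0 \<le> h (y + a \<cdot>\<^sub>v v) * h (y + b \<cdot>\<^sub>v v)"
        using inv[of "a \<cdot>\<^sub>v v" y] inv[of "b \<cdot>\<^sub>v v" y] linear_subspaceD(4)[OF C] by simp
    qed
    ultimately show ?thesis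
      using sum.subset_diff[OF CV finite_carrier_vec, of "?X a b"] by simp
  qed
  have "(\<Sum>y\<in>?V. (line_avg v h y)\<^sup>2) = (\<Sum>a\<in>UNIV. \<Sum>b\<in>UNIV. ?X a b v) / ?q\<^sup>2" for v
  proof -
    have "(\<Sum>y\<in>?V. (line_avg v h y)\<^sup>2) =
        (\<Sum>y\<in>?V. \<Sum>a\<in>UNIV. \<Sum>b\<in>UNIV. h (y + a \<cdot>\<^sub>v v) * h (y + b \<cdot>\<^sub>v v)) / ?q\<^sup>2"
      by (simp add: line_avg_def power_divide power2_eq_square sum_product sum_divide_distrib)
    also have "(\<Sum>y\<in>?V. \<Sum>a\<in>UNIV. \<Sum>b\<in>UNIV. h (y + a \<cdot>\<^sub>v v) * h (y + b \<cdot>\<^sub>v v)) =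
        (\<Sum>a\<in>UNIV. \<Sum>y\<in>?V. \<Sum>b\<in>UNIV. h (y + a \<cdot>\<^sub>v v) * h (y + b \<cdot>\<^sub>v v))"
      by (rule sum.swap)
    also have "\<dots> = (\<Sum>a\<in>UNIV. \<Sum>b\<in>UNIV. ?X a b v)"
      by (intro sum.cong refl) (rule sum.swap)
    finally show ?thesis .
  qed
  then have "(\<Sum>v\<in>?V - C. \<Sum>y\<in>?V. (line_avg v h y)\<^sup>2) =
      (\<Sum>v\<in>?V - C. \<Sum>a\<in>UNIV. \<Sum>b\<in>UNIV. ?X a b v) / ?q\<^sup>2"
    by (simp add: sum_divide_distrib)
  also have "(\<Sum>v\<in>?V - C. \<Sum>a\<in>UNIV. \<Sum>b\<in>UNIV. ?X a b v) =
      (\<Sum>a\<in>UNIV. \<Sum>v\<in>?V - C. \<Sum>b\<in>UNIV. ?X a b v)"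
    by (rule sum.swap)
  also have "\<dots> = (\<Sum>a\<in>UNIV. \<Sum>b\<in>UNIV. \<Sum>v\<in>?V - C. ?X a b v)"
    by (intro sum.cong refl) (rule sum.swap)
  also have "\<dots> \<le> (\<Sum>a::'a\<in>UNIV. \<Sum>b::'a\<in>UNIV. if a = b then card (?V - C) * ?H else 0)"
    using off by (intro sum_mono) (auto simp: diag)
  also have "\<dots> = ?q * (card (?V - C) * ?H)"
    by (simp add: sum.delta)
  finally have "(\<Sum>v\<in>?V - C. \<Sum>y\<in>?V. (line_avg v h y)\<^sup>2) \<le> card (?V - C) * ?H / ?q"
    by (simp add: power2_eq_square divide_right_mono)
  then have "(\<Sum>v\<in>?V - C. \<Sum>y\<in>?V. (line_avg v h y)\<^sup>2) / ?q ^ n \<le> card (?V - C) * ?H / ?q / ?q ^ n"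
    by (intro divide_right_mono) auto
  then show ?thesis
    by (simp add: vec_mean_def sum_divide_distrib[symmetric] mult_ac)
qed

text \<open>Apply \<open>sum_powr_le\<close> to the \<open>q\<close> points of each line. The
  diagonal yields \<open>q * q powr (- \<alpha>)\<close>. The off-diagonal pairs number at most the
  square of \<open>q\<close>, and by independence each gives a product of two means. The factor
  \<open>CARD('a) ^ n\<close> appears because the sum over \<open>v\<close> is not
  normalised.\<close>

lemma sum_line_avg_powr_le:
  fixes h :: "'a::{field,finite} vec \<Rightarrow> real" and \<alpha> :: real
  assumes "\<alpha> \<ge> 1" and U: "U \<subseteq> carrier_vec n"
  shows "(\<Sum>v\<in>U. vec_mean n (\<lambda>y. \<bar>line_avg v h y\<bar> powr \<alpha>)) \<le>
    card U * (CARD('a) powr (1 - \<alpha>) * vec_mean n (\<lambda>y. \<bar>h y\<bar> powr \<alpha>)) +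
    \<alpha> * CARD('a) * CARD('a) ^ n * (vec_mean n (\<lambda>y. \<bar>h y\<bar> powr (\<alpha> - 1)) * vec_mean n (\<lambda>y. \<bar>h y\<bar>))"
proof -
  let ?V = "carrier_vec n :: 'a vec set"
  let ?q = "real CARD('a)"
  let ?A = "\<lambda>p. \<Sum>y\<in>?V. \<bar>h y\<bar> powr p"
  let ?A1 = "\<Sum>y\<in>?V. \<bar>h y\<bar>"
  let ?X = "\<lambda>a b v. \<Sum>y\<in>?V. \<bar>h (y + a \<cdot>\<^sub>v v)\<bar> powr (\<alpha> - 1) * \<bar>h (y + b \<cdot>\<^sub>v v)\<bar>"
  have q: "?q > 0" by simp
  have fU: "finite U" using finite_subset[OF U] by simp
  have diag: "(\<Sum>y\<in>?V. \<bar>h (y + a \<cdot>\<^sub>v v)\<bar> powr \<alpha>) = ?A \<alpha>" if "v \<in> U" for a v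
    using sum_carrier_vec_translate[of "a \<cdot>\<^sub>v v" n "\<lambda>y. \<bar>h y\<bar> powr \<alpha>"] that U by auto
  have off: "(\<Sum>v\<in>U. ?X a b v) \<le> ?A (\<alpha> - 1) * ?A1" if "a \<noteq> b" for a b
  proof -
    \<comment> \<open>All terms are nonnegative, so the directions can be extended to the whole
      space, where independence is exact.\<close>
    have "(\<Sum>v\<in>U. ?X a b v) \<le> (\<Sum>v\<in>?V. ?X a b v)"
      using U by (intro sum_mono2 sum_nonneg) auto
    also have "\<dots> = ?A (\<alpha> - 1) * ?A1"
      by (rule sum_carrier_vec_pair[OF that, of "\<lambda>y. \<bar>h y\<bar> powr (\<alpha> - 1)" "\<lambda>y. \<bar>h y\<bar>" n])
    finally show ?thesis .
  qed
  have pt: "\<bar>line_avg v h y\<bar> powr \<alpha> \<le> ?q powr (- \<alpha>) * ((\<Sum>a\<in>UNIV. \<bar>h (y + a \<cdot>\<^sub>v v)\<bar> powr \<alpha>) +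
      \<alpha> * ?q powr (\<alpha> - 1) *
        (\<Sum>a\<in>UNIV. \<Sum>b\<in>UNIV - {a}. \<bar>h (y + a \<cdot>\<^sub>v v)\<bar> powr (\<alpha> - 1) * \<bar>h (y + b \<cdot>\<^sub>v v)\<bar>))" for v y
  proof -
    have "\<bar>line_avg v h y\<bar> powr \<alpha> = ?q powr (- \<alpha>) * \<bar>\<Sum>a\<in>UNIV. h (y + a \<cdot>\<^sub>v v)\<bar> powr \<alpha>"
      unfolding line_avg_def abs_divide by (simp add: powr_divide powr_minus field_simps)
    also have "\<dots> \<le> ?q powr (- \<alpha>) * (\<Sum>a\<in>UNIV. \<bar>h (y + a \<cdot>\<^sub>v v)\<bar>) powr \<alpha>"
      using assms by (intro mult_left_mono powr_mono2 sum_abs) auto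
    also have "\<dots> \<le> ?q powr (- \<alpha>) * ((\<Sum>a\<in>UNIV. \<bar>h (y + a \<cdot>\<^sub>v v)\<bar> powr \<alpha>) +
      \<alpha> * ?q powr (\<alpha> - 1) *
        (\<Sum>a\<in>UNIV. \<Sum>b\<in>UNIV - {a}. \<bar>h (y + a \<cdot>\<^sub>v v)\<bar> powr (\<alpha> - 1) * \<bar>h (y + b \<cdot>\<^sub>v v)\<bar>))"
      using assms by (intro mult_left_mono sum_powr_le) auto
    finally show ?thesis .
  qed
  have "(\<Sum>v\<in>U. \<Sum>y\<in>?V. \<bar>line_avg v h y\<bar> powr \<alpha>) \<le>
      (\<Sum>v\<in>U. \<Sum>y\<in>?V. ?q powr (- \<alpha>) * ((\<Sum>a\<in>UNIV. \<bar>h (y + a \<cdot>\<^sub>v v)\<bar> powr \<alpha>) +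
      \<alpha> * ?q powr (\<alpha> - 1) *
        (\<Sum>a\<in>UNIV. \<Sum>b\<in>UNIV - {a}. \<bar>h (y + a \<cdot>\<^sub>v v)\<bar> powr (\<alpha> - 1) * \<bar>h (y + b \<cdot>\<^sub>v v)\<bar>)))"
    by (intro sum_mono pt)
  also have "\<dots> = ?q powr (- \<alpha>) * ((\<Sum>v\<in>U. \<Sum>y\<in>?V. \<Sum>a\<in>UNIV. \<bar>h (y + a \<cdot>\<^sub>v v)\<bar> powr \<alpha>) +
      \<alpha> * ?q powr (\<alpha> - 1) * (\<Sum>v\<in>U. \<Sum>y\<in>?V. \<Sum>a\<in>UNIV. \<Sum>b\<in>UNIV - {a}.
         \<bar>h (y + a \<cdot>\<^sub>v v)\<bar> powr (\<alpha> - 1) * \<bar>h (y + b \<cdot>\<^sub>v v)\<bar>))"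
    by (simp only: sum_distrib_left[symmetric] sum.distrib)
  also have "(\<Sum>v\<in>U. \<Sum>y\<in>?V. \<Sum>a\<in>UNIV. \<bar>h (y + a \<cdot>\<^sub>v v)\<bar> powr \<alpha>) =
      (\<Sum>v\<in>U. \<Sum>a\<in>UNIV. \<Sum>y\<in>?V. \<bar>h (y + a \<cdot>\<^sub>v v)\<bar> powr \<alpha>)"
    by (intro sum.cong refl) (rule sum.swap)
  also have "\<dots> = card U * ?q * ?A \<alpha>" by (simp add: diag)
  also have "(\<Sum>v\<in>U. \<Sum>y\<in>?V. \<Sum>a\<in>UNIV. \<Sum>b\<in>UNIV - {a}.
         \<bar>h (y + a \<cdot>\<^sub>v v)\<bar> powr (\<alpha> - 1) * \<bar>h (y + b \<cdot>\<^sub>v v)\<bar>) =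
      (\<Sum>v\<in>U. \<Sum>a\<in>UNIV. \<Sum>b\<in>UNIV - {a}. ?X a b v)"
  proof (intro sum.cong refl)
    fix v
    have "(\<Sum>y\<in>?V. \<Sum>a\<in>UNIV. \<Sum>b\<in>UNIV - {a}.
         \<bar>h (y + a \<cdot>\<^sub>v v)\<bar> powr (\<alpha> - 1) * \<bar>h (y + b \<cdot>\<^sub>v v)\<bar>) =
       (\<Sum>a\<in>UNIV. \<Sum>y\<in>?V. \<Sum>b\<in>UNIV - {a}.
         \<bar>h (y + a \<cdot>\<^sub>v v)\<bar> powr (\<alpha> - 1) * \<bar>h (y + b \<cdot>\<^sub>v v)\<bar>)"
      by (rule sum.swap)
    also have "\<dots> = (\<Sum>a\<in>UNIV. \<Sum>b\<in>UNIV - {a}. ?X a b v)"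
      by (intro sum.cong refl) (rule sum.swap)
    finally show "(\<Sum>y\<in>?V. \<Sum>a\<in>UNIV. \<Sum>b\<in>UNIV - {a}.
         \<bar>h (y + a \<cdot>\<^sub>v v)\<bar> powr (\<alpha> - 1) * \<bar>h (y + b \<cdot>\<^sub>v v)\<bar>) =
      (\<Sum>a\<in>UNIV. \<Sum>b\<in>UNIV - {a}. ?X a b v)" .
  qed
  also have "(\<Sum>v\<in>U. \<Sum>a\<in>UNIV. \<Sum>b\<in>UNIV - {a}. ?X a b v) =
      (\<Sum>a\<in>UNIV. \<Sum>v\<in>U. \<Sum>b\<in>UNIV - {a}. ?X a b v)"
    by (rule sum.swap)
  also have "\<dots> = (\<Sum>a\<in>UNIV. \<Sum>b\<in>UNIV - {a}. \<Sum>v\<in>U. ?X a b v)"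
    by (intro sum.cong refl) (rule sum.swap)
  also have "?q powr (- \<alpha>) * (card U * ?q * ?A \<alpha> + \<alpha> * ?q powr (\<alpha> - 1) *
        (\<Sum>a\<in>UNIV. \<Sum>b\<in>UNIV - {a}. \<Sum>v\<in>U. ?X a b v)) \<le>
      ?q powr (- \<alpha>) * (card U * ?q * ?A \<alpha> + \<alpha> * ?q powr (\<alpha> - 1) *
        (\<Sum>a::'a\<in>UNIV. \<Sum>b::'a\<in>UNIV. ?A (\<alpha> - 1) * ?A1))"
  proof (intro mult_left_mono add_left_mono sum_mono)
    fix a :: 'a
    have "(\<Sum>b\<in>UNIV - {a}. \<Sum>v\<in>U. ?X a b v) \<le> (\<Sum>b\<in>UNIV - {a}. ?A (\<alpha> - 1) * ?A1)"
      using off by (intro sum_mono) auto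
    also have "\<dots> \<le> (\<Sum>b::'a\<in>UNIV. ?A (\<alpha> - 1) * ?A1)"
      by (intro sum_mono2) (auto intro!: mult_nonneg_nonneg sum_nonneg)
    finally show "(\<Sum>b\<in>UNIV - {a}. \<Sum>v\<in>U. ?X a b v) \<le> (\<Sum>b::'a\<in>UNIV. ?A (\<alpha> - 1) * ?A1)" .
  qed (use assms in auto)
  also have "\<dots> = card U * ((?q powr (- \<alpha>) * ?q) * ?A \<alpha>) +
      \<alpha> * (?q powr (- \<alpha>) * ?q powr (\<alpha> - 1) * ?q * ?q) * (?A (\<alpha> - 1) * ?A1)"
    by (simp add: algebra_simps)
  also have "?q powr (- \<alpha>) * ?q = ?q powr (1 - \<alpha>)"
    using powr_add[of ?q "- \<alpha>" 1] q by simp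
  also have "?q powr (- \<alpha>) * ?q powr (\<alpha> - 1) = ?q powr (- 1)"
    by (simp add: powr_add[symmetric])
  also have "?q powr (- 1) * ?q * ?q = ?q"
    using q by (simp add: powr_minus_divide)
  finally have "(\<Sum>v\<in>U. \<Sum>y\<in>?V. \<bar>line_avg v h y\<bar> powr \<alpha>) / ?q ^ n \<le>
     (card U * (?q powr (1 - \<alpha>) * ?A \<alpha>) + \<alpha> * ?q * (?A (\<alpha> - 1) * ?A1)) / ?q ^ n"
    by (intro divide_right_mono) auto
  then show ?thesis
    by (simp add: vec_mean_def sum_divide_distrib[symmetric] add_divide_distrib)
qed

subsection \<open>Adding one dimension to a random code\<close>

lemma integrable_linear_codes:
  fixes F :: "'a::{field,finite} vec set \<Rightarrow> real"
  assumes "k \<le> n"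
  shows "integrable (measure_pmf (pmf_of_set (linear_codes n k))) F"
  by (intro integrable_measure_pmf_finite)
    (simp add: finite_linear_codes linear_codes_nonempty[OF assms])

lemma expectation_linear_codes_mono:
  fixes F G :: "'a::{field,finite} vec set \<Rightarrow> real"
  assumes "k \<le> n" "\<And>C. linear_subspace n C \<Longrightarrow> card C = CARD('a) ^ k \<Longrightarrow> F C \<le> G C"
  shows "measure_pmf.expectation (pmf_of_set (linear_codes n k)) F \<le>
    measure_pmf.expectation (pmf_of_set (linear_codes n k)) G"
proof (intro integral_mono_AE integrable_linear_codes assms(1))
  show "AE C in measure_pmf (pmf_of_set (linear_codes n k)). F C \<le> G C"
    unfolding AE_measure_pmf_iff set_pmf_of_set[OF linear_codes_nonempty[OF assms(1)] finite_linear_codes]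
    using assms(2) by (auto simp: linear_codes_eq)
qed

text \<open>A bound on the average over all one-step extensions of a fixed code passes to
  expectations, since every code of dimension \<open>k\<close> leaves the same number of vectors
  outside it.\<close>

lemma expectation_linear_codes_Suc_le:
  fixes F G :: "'a::{field,finite} vec set \<Rightarrow> real"
  assumes k: "k < n"
    and FG: "\<And>C. linear_subspace n C \<Longrightarrow> card C = CARD('a) ^ k \<Longrightarrow>
      (\<Sum>v\<in>carrier_vec n - C. F (adjoin C v)) \<le> card (carrier_vec n - C) * G C"
  shows "measure_pmf.expectation (pmf_of_set (linear_codes n (Suc k))) F \<le>
    measure_pmf.expectation (pmf_of_set (linear_codes n k)) G"
proof -
  let ?V = "carrier_vec n :: 'a vec set"
  let ?L = "indep_lists n ?V"
  let ?D = "CARD('a) ^ n - CARD('a) ^ k"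
  note V = linear_subspace_carrier[of n, where 'a='a]
  have D: "real ?D > 0"
    using power_strict_increasing[OF k card_field_gt_1[where 'a='a]]
    by (simp only: of_nat_0_less_iff zero_less_diff)
  have card_diff: "card (?V - vec_span n vs) = ?D" if "vs \<in> ?L k" for vs
    using indep_listsD[OF V that] card_Diff_subset[of "vec_span n vs" ?V]
      finite_linear_subspace[of n "vec_span n vs"] by simp
  have "(\<Sum>vs\<in>?L (Suc k). F (vec_span n vs)) =
      (\<Sum>vs\<in>?L k. \<Sum>v\<in>?V - vec_span n vs. F (adjoin (vec_span n vs) v))"
    by (subst sum_indep_lists_Suc[OF V]) simp
  also have "\<dots> \<le> (\<Sum>vs\<in>?L k. real ?D * G (vec_span n vs))"
  proof (rule sum_mono)
    fix vs assume "vs \<in> ?L k"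
    then show "(\<Sum>v\<in>?V - vec_span n vs. F (adjoin (vec_span n vs) v)) \<le> real ?D * G (vec_span n vs)"
      using FG[of "vec_span n vs"] indep_listsD[OF V] card_diff by metis
  qed
  also have "\<dots> = real ?D * (\<Sum>vs\<in>?L k. G (vec_span n vs))"
    by (simp only: sum_distrib_left)
  finally have le: "(\<Sum>vs\<in>?L (Suc k). F (vec_span n vs)) \<le> real ?D * (\<Sum>vs\<in>?L k. G (vec_span n vs))" .
  have cardL: "real (card (?L (Suc k))) = real ?D * real (card (?L k))"
    by (simp only: card_indep_lists[OF V] prod.lessThan_Suc card_carrier_vec of_nat_mult mult.commute)
  have "(\<Sum>vs\<in>?L (Suc k). F (vec_span n vs)) / card (?L (Suc k)) \<le>
      real ?D * (\<Sum>vs\<in>?L k. G (vec_span n vs)) / card (?L (Suc k))"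
    using le by (intro divide_right_mono) auto
  also have "\<dots> = (\<Sum>vs\<in>?L k. G (vec_span n vs)) / card (?L k)"
    unfolding cardL using D by (simp only: mult_divide_mult_cancel_left less_imp_neq[symmetric] not_False_eq_True if_True)
  finally show ?thesis
    using k by (simp add: expectation_linear_codes del: indep_lists.simps)
qed

section \<open>Coset averages and the deviations of a density from 1\<close>

text \<open>Each element of the larger code is uniquely \<open>c + a \<cdot>\<^sub>v v\<close>, so
  averaging over its coset means averaging over cosets of \<open>C\<close> along a line. This is
  what reduces adding a dimension to the line estimates.\<close>

lemma coset_avg_adjoin:
  fixes f :: "'a::{field,finite} vec \<Rightarrow> real"
  assumes C: "linear_subspace n C" and v: "v \<in> carrier_vec n" "v \<notin> C" and y: "y \<in> carrier_vec n"
  shows "coset_avg (adjoin C v) f y = line_avg v (coset_avg C f) y"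
proof -
  have "(\<Sum>c\<in>C. \<Sum>a\<in>UNIV. f (y + (c + a \<cdot>\<^sub>v v))) = (\<Sum>c\<in>C. \<Sum>a\<in>UNIV. f (y + a \<cdot>\<^sub>v v + c))"
  proof (intro sum.cong refl arg_cong[of _ _ f])
    fix c a assume "c \<in> C"
    then have "c \<in> carrier_vec n" using linear_subspaceD(1)[OF C] by simp
    then show "y + (c + a \<cdot>\<^sub>v v) = y + a \<cdot>\<^sub>v v + c"
      using v y by (intro eq_vecI) auto
  qed
  also have "\<dots> = (\<Sum>a\<in>UNIV. \<Sum>c\<in>C. f (y + a \<cdot>\<^sub>v v + c))" by (rule sum.swap)
  finally show ?thesis
    by (simp add: coset_avg_def line_avg_def sum_adjoin[OF C v] card_adjoin[OF C v]
        sum_divide_distrib mult.commute)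
qed

lemma coset_avg_translate:
  fixes f :: "'a::{field,finite} vec \<Rightarrow> real"
  assumes C: "linear_subspace n C" and c: "c \<in> C" and y: "y \<in> carrier_vec n"
  shows "coset_avg C f (y + c) = coset_avg C f y"
proof -
  have "(\<Sum>d\<in>C. f (y + c + d)) = (\<Sum>d\<in>C. f (y + d))"
  proof (rule sum.reindex_bij_witness[of _ "\<lambda>d. d + (- 1) \<cdot>\<^sub>v c" "\<lambda>d. d + c"])
    fix d assume d: "d \<in> C"
    have cd: "c \<in> carrier_vec n" "d \<in> carrier_vec n" using c d linear_subspaceD(1)[OF C] by auto
    show "d + c + (- 1) \<cdot>\<^sub>v c = d" "d + (- 1) \<cdot>\<^sub>v c + c = d" using cd by (intro eq_vecI; auto)+
    show "d + c \<in> C" "d + (- 1) \<cdot>\<^sub>v c \<in> C"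
      using c d linear_subspaceD(3,4)[OF C] by auto
    have "y + (d + c) = y + c + d" using cd y by (intro eq_vecI) auto
    then show "f (y + (d + c)) = f (y + c + d)" by simp
  qed
  then show ?thesis by (simp add: coset_avg_def)
qed

lemma vec_mean_coset_avg:
  fixes f :: "'a::{field,finite} vec \<Rightarrow> real"
  assumes C: "linear_subspace n C"
  shows "vec_mean n (coset_avg C f) = vec_mean n f"
proof -
  have "card C > 0"
    using finite_linear_subspace[OF C] linear_subspaceD(2)[OF C] by (auto simp: card_gt_0_iff)
  have "(\<Sum>y\<in>carrier_vec n. \<Sum>c\<in>C. f (y + c)) = (\<Sum>c\<in>C. \<Sum>y\<in>carrier_vec n. f (y + c))"
    by (rule sum.swap)
  also have "\<dots> = (\<Sum>c\<in>C. \<Sum>y\<in>carrier_vec n. f y)"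
    using linear_subspaceD(1)[OF C] by (intro sum.cong refl sum_carrier_vec_translate) auto
  finally have "(\<Sum>y\<in>carrier_vec n. \<Sum>c\<in>C. f (y + c)) = card C * (\<Sum>y\<in>carrier_vec n. f y)"
    by simp
  then show ?thesis
    using \<open>card C > 0\<close> by (simp add: vec_mean_def coset_avg_def sum_divide_distrib[symmetric])
qed

lemma coset_avg_nonneg:
  fixes w :: "'a::{field,finite} vec \<Rightarrow> real"
  assumes C: "linear_subspace n C" and "\<And>y. y \<in> carrier_vec n \<Longrightarrow> 0 \<le> w y" and y: "y \<in> carrier_vec n"
  shows "0 \<le> coset_avg C w y"
  unfolding coset_avg_def
  using linear_subspaceD(1)[OF C] y by (intro divide_nonneg_nonneg sum_nonneg assms) auto

text \<open>\<open>w\<close> plays the role of a probability density relative to the uniform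
  distribution. The class of such functions is closed under \<open>coset_avg\<close>.\<close>

locale vec_density =
  fixes n :: nat and w :: "'a::{field,finite} vec \<Rightarrow> real" and \<alpha> q :: real
  assumes q_eq: "q = real CARD('a)"
    and nonneg: "\<And>y. y \<in> carrier_vec n \<Longrightarrow> 0 \<le> w y"
    and mean_1: "vec_mean n w = 1"
    and alpha: "\<alpha> > 2"
begin

definition deviation :: "'a vec set \<Rightarrow> 'a vec \<Rightarrow> real" where
  "deviation C y = coset_avg C w y - 1"

definition moment2 :: "'a vec set \<Rightarrow> real" where
  "moment2 C = vec_mean n (\<lambda>y. (deviation C y)\<^sup>2)"

definition moment :: "'a vec set \<Rightarrow> real" where
  "moment C = vec_mean n (\<lambda>y. \<bar>deviation C y\<bar> powr \<alpha>)"

lemma q_ge_2: "q \<ge> 2"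
  using card_field_gt_1[where 'a='a] by (simp add: q_eq)

lemma mean_deviation:
  assumes "linear_subspace n C"
  shows "vec_mean n (deviation C) = 0"
proof -
  have "vec_mean n (deviation C) = vec_mean n (\<lambda>y. coset_avg C w y - 1)"
    by (rule vec_mean_cong) (simp add: deviation_def)
  then show ?thesis using assms
    by (simp add: vec_mean_diff vec_mean_const vec_mean_coset_avg mean_1)
qed

text \<open>Both the coset average and the constant 1 are nonnegative with mean 1, so the triangle
  inequality gives a bound independent of \<open>w\<close> and \<open>C\<close>.\<close>

lemma mean_abs_deviation:
  assumes C: "linear_subspace n C"
  shows "vec_mean n (\<lambda>y. \<bar>deviation C y\<bar>) \<le> 2"
proof -
  have "vec_mean n (\<lambda>y. \<bar>deviation C y\<bar>) \<le> vec_mean n (\<lambda>y. coset_avg C w y + 1)"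
  proof (rule vec_mean_mono)
    fix y :: "'a vec" assume "y \<in> carrier_vec n"
    with coset_avg_nonneg[OF C nonneg] show "\<bar>deviation C y\<bar> \<le> coset_avg C w y + 1"
      by (simp add: deviation_def abs_le_iff)
  qed
  also have "\<dots> = 2"
    by (simp add: vec_mean_add vec_mean_const vec_mean_coset_avg[OF C] mean_1)
  finally show ?thesis .
qed

lemma deviation_adjoin:
  assumes "linear_subspace n C" "v \<in> carrier_vec n" "v \<notin> C" "y \<in> carrier_vec n"
  shows "deviation (adjoin C v) y = line_avg v (deviation C) y"
  unfolding deviation_def coset_avg_adjoin[OF assms]
  by (simp add: line_avg_def sum_subtractf diff_divide_distrib)

lemma moment2_step:
  assumes C: "linear_subspace n C"
  shows "(\<Sum>v\<in>carrier_vec n - C. moment2 (adjoin C v)) \<le> card (carrier_vec n - C) * (moment2 C / q)"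
proof -
  have "(\<Sum>v\<in>carrier_vec n - C. moment2 (adjoin C v)) =
      (\<Sum>v\<in>carrier_vec n - C. vec_mean n (\<lambda>y. (line_avg v (deviation C) y)\<^sup>2))"
    unfolding moment2_def using deviation_adjoin[OF C] by (intro sum.cong refl vec_mean_cong) auto
  also have "\<dots> \<le> card (carrier_vec n - C) * (moment2 C / q)"
    unfolding moment2_def q_eq
    by (intro sum_line_avg_power2_le[OF C] mean_deviation[OF C])
      (simp add: deviation_def coset_avg_translate[OF C])
  finally show ?thesis .
qed

text \<open>The diagonal part contracts by \<open>q powr (1 - \<alpha>)\<close>. In the cross term
  the mean of \<open>\<bar>h\<bar> powr (\<alpha> - 1)\<close> is split by
  \<open>powr_le_interpolate\<close>, where \<open>\<delta>\<close> decides how much is charged to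
  each of the two moments.\<close>

lemma moment_step:
  assumes C: "linear_subspace n C" and card: "card C = CARD('a) ^ i" and i: "i < n" and \<delta>: "\<delta> > 0"
  shows "(\<Sum>v\<in>carrier_vec n - C. moment (adjoin C v)) \<le> card (carrier_vec n - C) *
    ((q powr (1 - \<alpha>) + 4 * \<alpha> * q * \<delta>) * moment C + 2 * \<alpha> * q * \<delta> powr (2 - \<alpha>) * moment2 C)"
proof -
  let ?D = "real (card (carrier_vec n - C))"
  let ?m = "vec_mean n (\<lambda>y. \<bar>deviation C y\<bar>)"
  let ?m' = "vec_mean n (\<lambda>y. \<bar>deviation C y\<bar> powr (\<alpha> - 1))"
  have m: "0 \<le> ?m" by (intro vec_mean_nonneg) auto
  have m': "0 \<le> ?m'" by (intro vec_mean_nonneg) auto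
  have mom: "0 \<le> moment C" unfolding moment_def by (intro vec_mean_nonneg) auto
  have "?D = q ^ n - q ^ i"
  proof -
    have "CARD('a) ^ i \<le> CARD('a) ^ n" using i by (intro power_increasing) auto
    moreover have "card (carrier_vec n - C) = CARD('a) ^ n - CARD('a) ^ i"
      using card_Diff_subset[OF finite_linear_subspace[OF C], of "carrier_vec n"] C card
      by (simp add: linear_subspace_def)
    ultimately show ?thesis by (simp add: of_nat_diff q_eq)
  qed
  moreover have "2 * q ^ i \<le> q ^ n"
  proof -
    have "2 * q ^ i \<le> q ^ Suc i" using q_ge_2 by simp
    also have "\<dots> \<le> q ^ n" using i q_ge_2 by (intro power_increasing) auto
    finally show ?thesis .
  qed
  \<comment> \<open>At least half of all vectors lie outside \<open>C\<close>, so the unnormalised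
    factor \<open>q ^ n\<close> of the cross term can be measured against \<open>?D\<close>.\<close>
  ultimately have D: "q ^ n \<le> ?D * 2" by linarith
  have "?m' \<le> vec_mean n (\<lambda>y. \<delta> * \<bar>deviation C y\<bar> powr \<alpha> + \<delta> powr (2 - \<alpha>) * \<bar>deviation C y\<bar>)"
    using \<delta> alpha by (intro vec_mean_mono powr_le_interpolate) auto
  also have "\<dots> = \<delta> * moment C + \<delta> powr (2 - \<alpha>) * ?m"
    by (simp add: vec_mean_add vec_mean_cmult moment_def)
  finally have "?m' * ?m \<le> (\<delta> * moment C + \<delta> powr (2 - \<alpha>) * ?m) * ?m"
    using m by (intro mult_right_mono)
  also have "\<dots> = \<delta> * moment C * ?m + \<delta> powr (2 - \<alpha>) * ?m\<^sup>2"
    by (simp add: algebra_simps power2_eq_square)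
  \<comment> \<open>The mean absolute deviation is bounded by 2 in the first summand, whereas in the
    second its square is bounded by the second moment.\<close>
  also have "\<dots> \<le> \<delta> * moment C * 2 + \<delta> powr (2 - \<alpha>) * moment2 C"
  proof (intro add_mono mult_left_mono)
    show "?m\<^sup>2 \<le> moment2 C"
      using vec_mean_power2_le[of n "\<lambda>y. \<bar>deviation C y\<bar>"] by (simp add: moment2_def)
  qed (use mom \<delta> mean_abs_deviation[OF C] in auto)
  finally have mm: "?m' * ?m \<le> \<delta> * moment C * 2 + \<delta> powr (2 - \<alpha>) * moment2 C" .
  have "(\<Sum>v\<in>carrier_vec n - C. moment (adjoin C v)) =
      (\<Sum>v\<in>carrier_vec n - C. vec_mean n (\<lambda>y. \<bar>line_avg v (deviation C) y\<bar> powr \<alpha>))"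
    unfolding moment_def using deviation_adjoin[OF C] by (intro sum.cong refl vec_mean_cong) auto
  also have "\<dots> \<le> ?D * (q powr (1 - \<alpha>) * moment C) + \<alpha> * q * q ^ n * (?m' * ?m)"
    unfolding moment_def q_eq using sum_line_avg_powr_le[of \<alpha> "carrier_vec n - C" n "deviation C"] alpha by simp
  also have "\<dots> \<le> ?D * (q powr (1 - \<alpha>) * moment C) +
      \<alpha> * q * (?D * 2) * (\<delta> * moment C * 2 + \<delta> powr (2 - \<alpha>) * moment2 C)"
    using D mm m m' alpha q_ge_2 by (intro add_left_mono mult_mono mult_left_mono) auto
  also have "\<dots> = ?D * ((q powr (1 - \<alpha>) + 4 * \<alpha> * q * \<delta>) * moment C +
      2 * \<alpha> * q * \<delta> powr (2 - \<alpha>) * moment2 C)"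
    by (simp add: algebra_simps)
  finally show ?thesis .
qed

end

subsection \<open>The moments of a random code\<close>

text \<open>The exponential bounds the product of all growth factors, whose excess decays with ratio
  \<open>q powr (- 1 / 2)\<close>. The second factor collects the initial value 2 and the additive
  errors, which decay with ratio \<open>q powr (- (\<alpha> - 2) / 2)\<close>.\<close>

definition smoothing_const :: "real \<Rightarrow> real \<Rightarrow> real" where
  "smoothing_const \<alpha> q = exp (4 * \<alpha> * q powr \<alpha> / (1 - q powr (- 1 / 2))) *
     (2 + 2 * \<alpha> * q powr \<alpha> / (1 - q powr (- (\<alpha> - 2) / 2)))"

context vec_density
begin

abbreviation E :: "nat \<Rightarrow> ('a vec set \<Rightarrow> real) \<Rightarrow> real" where
  "E k F \<equiv> measure_pmf.expectation (pmf_of_set (linear_codes n k)) F"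

lemma deviation_zero:
  assumes "y \<in> carrier_vec n"
  shows "deviation {0\<^sub>v n} y = w y - 1"
  using assms by (simp add: deviation_def coset_avg_def)

lemma E_0: "E 0 F = F {0\<^sub>v n}"
  by (subst expectation_linear_codes) auto

text \<open>Jensen's inequality: average the tangent at 1.\<close>

lemma power_moment_ge_1: "1 \<le> vec_mean n (\<lambda>y. w y powr \<alpha>)"
proof -
  have "1 = vec_mean n (\<lambda>y. (1 + \<alpha> * w y) - \<alpha>)"
    by (simp add: vec_mean_diff vec_mean_add vec_mean_cmult vec_mean_const mean_1)
  also have "\<dots> \<le> vec_mean n (\<lambda>y. w y powr \<alpha>)"
  proof (rule vec_mean_mono)
    fix y :: "'a vec" assume "y \<in> carrier_vec n"
    with nonneg show "(1 + \<alpha> * w y) - \<alpha> \<le> w y powr \<alpha>"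
      using powr_tangent[of "w y" 1 \<alpha>] alpha by (simp add: algebra_simps)
  qed
  finally show ?thesis .
qed

text \<open>Under the probability weight \<open>w\<close>, the two means are those of
  \<open>w\<close> and \<open>w powr (\<alpha> - 1)\<close>, so this is again Jensen's inequality;
  it amounts to monotonicity of Renyi entropy in its order.\<close>

lemma mean_power2_le:
  assumes Q: "Q > 0" and le: "vec_mean n (\<lambda>y. w y powr \<alpha>) \<le> Q powr (\<alpha> - 1)"
  shows "vec_mean n (\<lambda>y. (w y)\<^sup>2) \<le> Q"
proof -
  let ?m = "vec_mean n (\<lambda>y. (w y)\<^sup>2)"
  let ?s = "\<alpha> - 1"
  have m: "?m \<ge> 0" by (intro vec_mean_nonneg) auto
  \<comment> \<open>The integrand is the tangent of \<open>x powr ?s\<close> at \<open>?m\<close>,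
    taken at \<open>w y\<close> and multiplied by \<open>w y\<close>. Since \<open>w\<close> has
    mean 1 and its square has mean \<open>?m\<close>, the slope terms cancel.\<close>
  have "?m powr ?s = vec_mean n (\<lambda>y. (?m powr ?s - ?s * ?m powr (?s - 1) * ?m) * w y +
      ?s * ?m powr (?s - 1) * (w y)\<^sup>2)"
    by (simp add: vec_mean_add vec_mean_cmult mean_1)
  also have "\<dots> \<le> vec_mean n (\<lambda>y. w y powr \<alpha>)"
  proof (rule vec_mean_mono)
    fix y :: "'a vec" assume "y \<in> carrier_vec n"
    then have w: "w y \<ge> 0" by (rule nonneg)
    have "(?m powr ?s + ?s * ?m powr (?s - 1) * (w y - ?m)) * w y \<le> w y powr ?s * w y"
      using w m alpha by (intro mult_right_mono powr_tangent) auto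
    also have "w y powr ?s * w y = w y powr \<alpha>"
      using w by (cases "w y = 0") (simp_all add: powr_diff)
    finally show "(?m powr ?s - ?s * ?m powr (?s - 1) * ?m) * w y +
      ?s * ?m powr (?s - 1) * (w y)\<^sup>2 \<le> w y powr \<alpha>"
      by (simp add: algebra_simps power2_eq_square)
  qed
  finally have "?m powr ?s \<le> Q powr ?s" using le by simp
  show ?thesis
  proof (rule ccontr)
    assume "\<not> ?m \<le> Q"
    then have "Q powr ?s < ?m powr ?s" using Q alpha by (intro powr_less_mono2) auto
    with \<open>?m powr ?s \<le> Q powr ?s\<close> show False by simp
  qed
qed

lemma E_moment2_le:
  assumes Q: "Q > 0" and le: "vec_mean n (\<lambda>y. w y powr \<alpha>) \<le> Q powr (\<alpha> - 1)" and i: "i \<le> n"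
  shows "E i moment2 \<le> Q / q ^ i"
  using i
proof (induction i)
  case 0
  have "moment2 {0\<^sub>v n} = vec_mean n (\<lambda>y. ((w y)\<^sup>2 + 1) - 2 * w y)"
    unfolding moment2_def by (rule vec_mean_cong) (simp add: deviation_zero power2_diff)
  also have "\<dots> = vec_mean n (\<lambda>y. (w y)\<^sup>2) - 1"
    by (simp add: vec_mean_diff vec_mean_add vec_mean_cmult vec_mean_const mean_1)
  finally show ?case using mean_power2_le[OF Q le] by (simp add: E_0)
next
  case (Suc i)
  have "E (Suc i) moment2 \<le> E i (\<lambda>C. moment2 C / q)"
    using Suc.prems by (intro expectation_linear_codes_Suc_le moment2_step) auto
  also have "\<dots> = E i moment2 / q" by simp
  also have "\<dots> \<le> (Q / q ^ i) / q"
    using Suc q_ge_2 by (intro divide_right_mono) auto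
  finally show ?case by (simp add: mult.commute)
qed

lemma E_moment_Suc_le:
  assumes i: "i < n" and \<delta>: "\<delta> > 0"
  shows "E (Suc i) moment \<le>
    (q powr (1 - \<alpha>) + 4 * \<alpha> * q * \<delta>) * E i moment + 2 * \<alpha> * q * \<delta> powr (2 - \<alpha>) * E i moment2"
proof -
  have "E (Suc i) moment \<le> E i (\<lambda>C. (q powr (1 - \<alpha>) + 4 * \<alpha> * q * \<delta>) * moment C +
      2 * \<alpha> * q * \<delta> powr (2 - \<alpha>) * moment2 C)"
    using i \<delta> by (intro expectation_linear_codes_Suc_le moment_step) auto
  also have "\<dots> = E i (\<lambda>C. (q powr (1 - \<alpha>) + 4 * \<alpha> * q * \<delta>) * moment C) +
      E i (\<lambda>C. 2 * \<alpha> * q * \<delta> powr (2 - \<alpha>) * moment2 C)"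
    using i by (intro Bochner_Integration.integral_add integrable_linear_codes) auto
  finally show ?thesis by simp
qed

text \<open>Rescaling by \<open>q powr ((\<alpha> - 1) * i)\<close> turns the contraction factor
  into 1, leaving a recursion with small multiplicative losses \<open>d\<close> and additive errors
  \<open>e\<close>. Both decay geometrically away from the last step, so
  \<open>discrete_gronwall\<close> costs only a constant.\<close>

lemma E_moment_le:
  assumes Q: "Q > 0" and le: "vec_mean n (\<lambda>y. w y powr \<alpha>) \<le> Q powr (\<alpha> - 1)"
    and k: "k \<le> n" and Qk: "Q \<le> q ^ k"
  shows "E k moment \<le> smoothing_const \<alpha> q * (Q / q ^ k)"
proof -
  define r where "r = q powr (- 1 / 2)"
  define s where "s = q powr (- (\<alpha> - 2) / 2)"
  define u where "u = (\<lambda>i::nat. q powr ((\<alpha> - 1) * i) * E i moment)"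
  define d where "d = (\<lambda>i::nat. 4 * \<alpha> * q powr \<alpha> * r ^ (k - i))"
  define e where "e = (\<lambda>i::nat. 2 * \<alpha> * q powr \<alpha> * (Q * q powr ((\<alpha> - 2) * k)) * s ^ (k - i))"
  have q: "q > 1" using q_ge_2 by simp
  have r: "0 < r" "r < 1" unfolding r_def using q powr_less_cancel_iff[of q "- 1 / 2" 0] by simp_all
  have s: "0 < s" "s < 1" unfolding s_def using q alpha powr_less_cancel_iff[of q "- (\<alpha> - 2) / 2" 0]
    by simp_all
  have Pnn: "E i moment \<ge> 0" for i
    by (intro Bochner_Integration.integral_nonneg) (simp add: moment_def vec_mean_nonneg)
  have step: "u (Suc i) \<le> (1 + d i) * u i + e i" if i: "i < k" for i
  proof -
    let ?\<delta> = "r ^ (k - i)"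
    have pw: "(q powr a) ^ (k - i) = q powr (a * (real k - real i))" for a
      using q i by (simp add: powr_realpow[symmetric] powr_powr of_nat_diff)
    have rk: "?\<delta> = q powr (- (real k - real i) / 2)"
      unfolding r_def pw by (intro arg_cong[where f = "\<lambda>x. q powr x"]) (simp add: field_simps)
    have sk: "s ^ (k - i) = q powr (- (\<alpha> - 2) * (real k - real i) / 2)"
      unfolding s_def pw by simp
    have r2: "?\<delta> powr (2 - \<alpha>) = q powr ((\<alpha> - 2) * (real k - real i) / 2)"
      unfolding rk powr_powr by (intro arg_cong[where f = "\<lambda>x. q powr x"]) (simp add: algebra_simps)
    have qi: "q ^ i = q powr real i" using q by (simp add: powr_realpow)
    let ?c = "q powr ((\<alpha> - 1) * Suc i)"
    have c1: "?c * q powr (1 - \<alpha>) = q powr ((\<alpha> - 1) * i)"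
      unfolding powr_add[symmetric] by (intro arg_cong[where f = "\<lambda>x. q powr x"]) (simp add: algebra_simps)
    have "?c * q = ?c * q powr 1" using q by simp
    also have "\<dots> = q powr \<alpha> * q powr ((\<alpha> - 1) * i)"
      unfolding powr_add[symmetric] by (intro arg_cong[where f = "\<lambda>x. q powr x"]) (simp add: algebra_simps)
    finally have c2: "?c * q = q powr \<alpha> * q powr ((\<alpha> - 1) * i)" .
    \<comment> \<open>Apart from \<open>\<alpha>\<close>, the exponents sum to
      \<open>(\<alpha> - 2) * i + (\<alpha> - 2) * (k - i) / 2\<close>, which is
      \<open>(\<alpha> - 2) * k\<close> minus half of \<open>(\<alpha> - 2) * (k - i)\<close>. This
      deficit is the decay \<open>s ^ (k - i)\<close>.\<close>
    have "q powr \<alpha> * q powr ((\<alpha> - 1) * i) * ?\<delta> powr (2 - \<alpha>) / q ^ i =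
        q powr \<alpha> * q powr ((\<alpha> - 1) * i) * ?\<delta> powr (2 - \<alpha>) * q powr (- real i)"
      unfolding qi by (simp add: powr_minus divide_inverse)
    also have "\<dots> = q powr \<alpha> * q powr ((\<alpha> - 2) * k) * s ^ (k - i)"
      unfolding r2 sk powr_add[symmetric]
      by (intro arg_cong[where f = "\<lambda>x. q powr x"]) (simp add: algebra_simps add_divide_distrib diff_divide_distrib)
    finally have c3: "q powr \<alpha> * q powr ((\<alpha> - 1) * i) * ?\<delta> powr (2 - \<alpha>) / q ^ i =
        q powr \<alpha> * q powr ((\<alpha> - 2) * k) * s ^ (k - i)" .
    have "E (Suc i) moment \<le> (q powr (1 - \<alpha>) + 4 * \<alpha> * q * ?\<delta>) * E i moment +
        2 * \<alpha> * q * ?\<delta> powr (2 - \<alpha>) * E i moment2"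
      using i k r by (intro E_moment_Suc_le) auto
    also have "\<dots> \<le> (q powr (1 - \<alpha>) + 4 * \<alpha> * q * ?\<delta>) * E i moment +
        2 * \<alpha> * q * ?\<delta> powr (2 - \<alpha>) * (Q / q ^ i)"
      using i k alpha q by (intro add_left_mono mult_left_mono E_moment2_le[OF Q le]) auto
    finally have "u (Suc i) \<le> ?c * ((q powr (1 - \<alpha>) + 4 * \<alpha> * q * ?\<delta>) * E i moment +
        2 * \<alpha> * q * ?\<delta> powr (2 - \<alpha>) * (Q / q ^ i))"
      unfolding u_def by (intro mult_left_mono) auto
    also have "\<dots> = (?c * q powr (1 - \<alpha>)) * E i moment + 4 * \<alpha> * ?\<delta> * (?c * q) * E i moment +
        2 * \<alpha> * Q * ((?c * q) * ?\<delta> powr (2 - \<alpha>) / q ^ i)"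
      by (simp add: algebra_simps)
    also have "\<dots> = (1 + d i) * u i + e i"
      unfolding c1 c2 c3 by (simp add: u_def d_def e_def algebra_simps)
    finally show ?thesis .
  qed
  have dnn: "d i \<ge> 0" for i using alpha r by (simp add: d_def)
  have enn: "e i \<ge> 0" for i using alpha s Q by (simp add: e_def)
  have unn: "u 0 \<ge> 0" using Pnn by (simp add: u_def)
  have uk: "u k \<le> exp (\<Sum>i<k. d i) * (u 0 + (\<Sum>i<k. e i))"
    by (rule discrete_gronwall) (use step unn dnn enn in auto)
  have sumd: "(\<Sum>i<k. d i) \<le> 4 * \<alpha> * q powr \<alpha> / (1 - r)"
  proof -
    have "(\<Sum>i<k. d i) = 4 * \<alpha> * q powr \<alpha> * (\<Sum>i<k. r ^ (k - i))"
      by (simp only: d_def sum_distrib_left)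
    also have "\<dots> \<le> 4 * \<alpha> * q powr \<alpha> * (1 / (1 - r))"
      using alpha r by (intro mult_left_mono sum_power_diff_le) auto
    finally show ?thesis by simp
  qed
  have sume: "(\<Sum>i<k. e i) \<le> 2 * \<alpha> * q powr \<alpha> / (1 - s) * (Q * q powr ((\<alpha> - 2) * k))"
  proof -
    have "(\<Sum>i<k. e i) = 2 * \<alpha> * q powr \<alpha> * (Q * q powr ((\<alpha> - 2) * k)) * (\<Sum>i<k. s ^ (k - i))"
      by (simp only: e_def sum_distrib_left)
    also have "\<dots> \<le> 2 * \<alpha> * q powr \<alpha> * (Q * q powr ((\<alpha> - 2) * k)) * (1 / (1 - s))"
      using alpha s Q by (intro mult_left_mono sum_power_diff_le) auto
    finally show ?thesis by (simp add: mult_ac)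
  qed
  have u0: "u 0 \<le> 2 * (Q * q powr ((\<alpha> - 2) * k))"
  proof -
    have "u 0 = moment {0\<^sub>v n}" using q by (simp add: u_def E_0)
    also have "\<dots> \<le> vec_mean n (\<lambda>y. w y powr \<alpha> + 1)"
      unfolding moment_def
    proof (rule vec_mean_mono)
      fix y :: "'a vec" assume y: "y \<in> carrier_vec n"
      have w: "w y \<ge> 0" using nonneg[OF y] .
      show "\<bar>deviation {0\<^sub>v n} y\<bar> powr \<alpha> \<le> w y powr \<alpha> + 1"
      proof (cases "w y \<ge> 1")
        case True
        then have "\<bar>w y - 1\<bar> powr \<alpha> \<le> w y powr \<alpha>" using alpha by (intro powr_mono2) auto
        then show ?thesis by (simp add: deviation_zero[OF y])
      next
        case False
        then have "\<bar>w y - 1\<bar> powr \<alpha> \<le> 1 powr \<alpha>" using alpha w by (intro powr_mono2) auto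
        then show ?thesis by (simp add: deviation_zero[OF y] add_increasing)
      qed
    qed
    also have "\<dots> = vec_mean n (\<lambda>y. w y powr \<alpha>) + 1"
      by (simp add: vec_mean_add vec_mean_const)
    \<comment> \<open>The summand 1 is absorbed because the mean of \<open>w powr \<alpha>\<close>
      is at least 1.\<close>
    also have "\<dots> \<le> 2 * Q powr (\<alpha> - 1)"
      using power_moment_ge_1 le by simp
    \<comment> \<open>One factor \<open>Q\<close> is kept for the final bound; the remaining power
      is estimated by \<open>Q \<le> q ^ k\<close>, matching the scale of the additive
      errors.\<close>
    also have "Q powr (\<alpha> - 1) = Q * Q powr (\<alpha> - 2)"
      using Q powr_add[of Q 1 "\<alpha> - 2"] by simp
    also have "Q powr (\<alpha> - 2) \<le> (q ^ k) powr (\<alpha> - 2)"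
      using Q Qk alpha by (intro powr_mono2) auto
    also have "(q ^ k) powr (\<alpha> - 2) = q powr ((\<alpha> - 2) * k)"
      using q by (simp add: powr_realpow[symmetric] powr_powr mult.commute)
    finally show ?thesis using Q by (simp add: mult_left_mono)
  qed
  let ?R = "Q * q powr ((\<alpha> - 2) * k)"
  have "u k \<le> exp (4 * \<alpha> * q powr \<alpha> / (1 - r)) * (2 * ?R + 2 * \<alpha> * q powr \<alpha> / (1 - s) * ?R)"
    using uk
  proof (rule order_trans)
    show "exp (\<Sum>i<k. d i) * (u 0 + (\<Sum>i<k. e i)) \<le>
        exp (4 * \<alpha> * q powr \<alpha> / (1 - r)) * (2 * ?R + 2 * \<alpha> * q powr \<alpha> / (1 - s) * ?R)"
      using sumd sume u0 unn enn by (intro mult_mono add_mono) (auto intro!: add_nonneg_nonneg sum_nonneg)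
  qed
  also have "\<dots> = smoothing_const \<alpha> q * ?R"
    by (simp add: smoothing_const_def r_def s_def algebra_simps)
  finally have "u k \<le> smoothing_const \<alpha> q * ?R" .
  \<comment> \<open>Undoing the rescaling at \<open>i = k\<close> leaves exactly
    \<open>Q / q ^ k\<close>.\<close>
  then have "q powr (- (\<alpha> - 1) * k) * u k \<le> q powr (- (\<alpha> - 1) * k) * (smoothing_const \<alpha> q * ?R)"
    by (intro mult_left_mono) auto
  also have "\<dots> = smoothing_const \<alpha> q * (Q * (q powr (- (\<alpha> - 1) * k) * q powr ((\<alpha> - 2) * k)))"
    by (simp only: mult_ac)
  also have "q powr (- (\<alpha> - 1) * k) * q powr ((\<alpha> - 2) * k) = q powr (- real k)"
    unfolding powr_add[symmetric] by (intro arg_cong[where f = "\<lambda>x. q powr x"]) (simp add: algebra_simps)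
  also have "q powr (- real k) = 1 / q ^ k"
    using q by (simp add: powr_minus_divide powr_realpow)
  also have "q powr (- (\<alpha> - 1) * k) * u k = E k moment"
    using q by (simp add: u_def mult.assoc[symmetric] powr_add[symmetric] algebra_simps)
  finally show ?thesis by simp
qed

text \<open>Apply \<open>powr_le_taylor\<close> pointwise to the coset average. The linear term has
  mean 0, and the two remaining means are the moments already bounded.\<close>

lemma E_power_moment_le:
  assumes Q: "Q > 0" and le: "vec_mean n (\<lambda>y. w y powr \<alpha>) \<le> Q powr (\<alpha> - 1)"
    and k: "k \<le> n" and Qk: "Q \<le> q ^ k"
  shows "E k (\<lambda>C. vec_mean n (\<lambda>y. coset_avg C w y powr \<alpha>)) \<le>
    1 + \<alpha> * (\<alpha> - 1) * 2 powr \<alpha> * (1 + smoothing_const \<alpha> q) * (Q / q ^ k)"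
proof -
  let ?c = "\<alpha> * (\<alpha> - 1) * 2 powr \<alpha>"
  have "E k (\<lambda>C. vec_mean n (\<lambda>y. coset_avg C w y powr \<alpha>)) \<le> E k (\<lambda>C. 1 + ?c * (moment2 C + moment C))"
  proof (intro expectation_linear_codes_mono k)
    fix C :: "'a vec set" assume C: "linear_subspace n C"
    have "vec_mean n (\<lambda>y. coset_avg C w y powr \<alpha>) \<le>
        vec_mean n (\<lambda>y. 1 + \<alpha> * deviation C y + ?c * ((deviation C y)\<^sup>2 + \<bar>deviation C y\<bar> powr \<alpha>))"
      unfolding deviation_def using coset_avg_nonneg[OF C nonneg] alpha
      by (intro vec_mean_mono powr_le_taylor) auto
    also have "\<dots> = 1 + ?c * (moment2 C + moment C)"
      by (simp only: vec_mean_add vec_mean_cmult vec_mean_const mean_deviation[OF C] moment2_def moment_def)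
    finally show "vec_mean n (\<lambda>y. coset_avg C w y powr \<alpha>) \<le> 1 + ?c * (moment2 C + moment C)" .
  qed
  also have "\<dots> = 1 + ?c * (E k moment2 + E k moment)"
    by (simp add: integrable_linear_codes[OF k])
  also have "\<dots> \<le> 1 + ?c * (Q / q ^ k + smoothing_const \<alpha> q * (Q / q ^ k))"
    using alpha by (intro add_left_mono mult_left_mono add_mono E_moment2_le E_moment_le assms) auto
  finally show ?thesis by (simp add: algebra_simps)
qed

text \<open>The coset average is itself a density, so the locale can be instantiated with
  it.\<close>

lemma power_moment_coset_avg_ge_1:
  assumes C: "linear_subspace n C"
  shows "1 \<le> vec_mean n (\<lambda>y. coset_avg C w y powr \<alpha>)"
proof -
  interpret C: vec_density n "coset_avg C w" \<alpha> q
    using C nonneg mean_1 alpha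
    by unfold_locales (simp_all add: q_eq coset_avg_nonneg vec_mean_coset_avg)
  show ?thesis by (rule C.power_moment_ge_1)
qed

end

subsection \<open>The smoothing divergence\<close>

text \<open>Conditioning on the codeword gives the average of the noise probabilities at
  \<open>y\<close> minus \<open>c\<close>; a subspace is closed under negation, which changes the
  sign to the one in \<open>coset_avg\<close>.\<close>

lemma pmf_indep_sum_pmf_of_set:
  fixes W :: "'a::{field,finite} vec pmf"
  assumes C: "linear_subspace n C" and W: "set_pmf W \<subseteq> carrier_vec n" and y: "y \<in> carrier_vec n"
  shows "pmf (indep_sum_pmf (pmf_of_set C) W) y = coset_avg C (pmf W) y"
proof -
  have fin: "finite C" and ne: "C \<noteq> {}"
    using finite_linear_subspace[OF C] linear_subspaceD(2)[OF C] by auto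
  have neg: "(- 1) \<cdot>\<^sub>v ((- 1) \<cdot>\<^sub>v c) = c" if "c \<in> C" for c :: "'a vec"
    using linear_subspaceD(1)[OF C that] by (intro eq_vecI) auto
  have shift: "pmf (map_pmf (\<lambda>x. c + x) W) y = pmf W (y + (- 1) \<cdot>\<^sub>v c)" if "c \<in> C" for c
  proof -
    have c: "c \<in> carrier_vec n" using linear_subspaceD(1)[OF C that] .
    have "c + x = y \<longleftrightarrow> x = y + (- 1) \<cdot>\<^sub>v c" if x: "x \<in> carrier_vec n" for x
    proof
      assume "c + x = y"
      then have "vec_index y i = vec_index c i + vec_index x i" if "i < n" for i
        using that c x by auto
      then show "x = y + (- 1) \<cdot>\<^sub>v c" using c x y by (intro eq_vecI) auto
    next
      assume "x = y + (- 1) \<cdot>\<^sub>v c"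
      then show "c + x = y" using c y by (intro eq_vecI) auto
    qed
    then have "(\<lambda>x. c + x) -` {y} \<inter> set_pmf W = {y + (- 1) \<cdot>\<^sub>v c} \<inter> set_pmf W"
      using W by auto
    then have "measure W ((\<lambda>x. c + x) -` {y}) = measure W {y + (- 1) \<cdot>\<^sub>v c}"
      by (metis measure_Int_set_pmf)
    then show ?thesis by (simp add: pmf_map measure_pmf_single)
  qed
  have "indep_sum_pmf (pmf_of_set C) W = bind_pmf (pmf_of_set C) (\<lambda>c. map_pmf (\<lambda>x. c + x) W)"
    by (simp add: indep_sum_pmf_def pair_pmf_def map_bind_pmf map_pmf_def bind_assoc_pmf bind_return_pmf)
  then have "pmf (indep_sum_pmf (pmf_of_set C) W) y =
      (\<Sum>c\<in>C. pmf (map_pmf (\<lambda>x. c + x) W) y) / card C"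
    by (simp add: pmf_bind integral_pmf_of_set fin ne)
  also have "(\<Sum>c\<in>C. pmf (map_pmf (\<lambda>x. c + x) W) y) = (\<Sum>c\<in>C. pmf W (y + c))"
    by (rule sum.reindex_bij_witness[of _ "\<lambda>c. (- 1) \<cdot>\<^sub>v c" "\<lambda>c. (- 1) \<cdot>\<^sub>v c"])
      (simp_all add: shift neg linear_subspaceD(4)[OF C])
  finally show ?thesis by (simp add: coset_avg_def)
qed

text \<open>With \<open>N\<close> points, a uniform probability raised to
  \<open>1 - \<alpha>\<close> is \<open>N powr (\<alpha> - 1)\<close>. One more factor
  \<open>N\<close> turns probabilities into densities and is compensated by the mean.\<close>

lemma smoothing_divergence_eq:
  fixes W :: "'a::{field,finite} vec pmf"
  assumes C: "linear_subspace n C" and W: "set_pmf W \<subseteq> carrier_vec n"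
  shows "smoothing_divergence \<alpha> n W C = 1 / (\<alpha> - 1) * log CARD('a)
    (vec_mean n (\<lambda>y. coset_avg C (\<lambda>x. CARD('a) ^ n * pmf W x) y powr \<alpha>))"
proof -
  let ?N = "real CARD('a) ^ n"
  have N: "?N > 0" by simp
  have ne: "carrier_vec n \<noteq> ({} :: 'a vec set)" by (metis empty_iff zero_carrier_vec)
  have "(\<Sum>y\<in>carrier_vec n. pmf (indep_sum_pmf (pmf_of_set C) W) y powr \<alpha> *
      pmf (pmf_of_set (carrier_vec n)) y powr (1 - \<alpha>)) =
    (\<Sum>y\<in>carrier_vec n. coset_avg C (\<lambda>x. ?N * pmf W x) y powr \<alpha> / ?N)"
  proof (rule sum.cong)
    fix y :: "'a vec" assume y: "y \<in> carrier_vec n"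
    have "coset_avg C (\<lambda>x. ?N * pmf W x) y = ?N * coset_avg C (pmf W) y"
      by (simp add: coset_avg_def sum_distrib_left)
    moreover have "coset_avg C (pmf W) y \<ge> 0"
      by (rule coset_avg_nonneg[OF C _ y]) simp
    moreover have "?N powr \<alpha> = ?N / ?N powr (1 - \<alpha>)"
      using powr_diff[of ?N 1 "1 - \<alpha>"] by simp
    ultimately have "coset_avg C (\<lambda>x. ?N * pmf W x) y powr \<alpha> / ?N =
        coset_avg C (pmf W) y powr \<alpha> * (1 / ?N) powr (1 - \<alpha>)"
      by (simp add: powr_mult powr_divide)
    then show "pmf (indep_sum_pmf (pmf_of_set C) W) y powr \<alpha> *
        pmf (pmf_of_set (carrier_vec n)) y powr (1 - \<alpha>) =
        coset_avg C (\<lambda>x. ?N * pmf W x) y powr \<alpha> / ?N"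
      using y ne by (simp add: pmf_indep_sum_pmf_of_set[OF C W] pmf_of_set)
  qed simp
  then show ?thesis
    by (simp add: smoothing_divergence_def renyi_divergence_def vec_mean_def sum_divide_distrib)
qed

text \<open>The entropy is the logarithm of the power moment of the density up to scaling, so the
  rate condition is exactly the moment bound with \<open>Q = q powr (k - \<epsilon> * n)\<close>.
  Then \<open>Q / q ^ k\<close> is the claimed decay.\<close>

lemma smoothing_bounds:
  fixes W :: "'a::{field,finite} vec pmf" and \<alpha> \<epsilon> :: real
  defines "q \<equiv> real CARD('a)"
  defines "K \<equiv> \<alpha> * (\<alpha> - 1) * 2 powr \<alpha> * (1 + smoothing_const \<alpha> q)"
  assumes alpha: "\<alpha> > 2" and eps: "\<epsilon> > 0" and n: "n \<ge> 1" and W: "set_pmf W \<subseteq> carrier_vec n"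
    and k: "k \<le> n"
    and rate: "real k / real n \<ge> 1 - renyi_entropy q \<alpha> (carrier_vec n) W / real n + \<epsilon>"
  shows "measure_pmf.expectation (pmf_of_set (linear_codes n k))
      (\<lambda>C. q powr ((\<alpha> - 1) * smoothing_divergence \<alpha> n W C)) \<le> 1 + K * q powr (- (\<epsilon> * n))" (is ?bound)
    and "0 \<le> measure_pmf.expectation (pmf_of_set (linear_codes n k)) (smoothing_divergence \<alpha> n W)" (is ?nonneg)
    and "measure_pmf.expectation (pmf_of_set (linear_codes n k)) (smoothing_divergence \<alpha> n W) \<le>
      K / ((\<alpha> - 1) * ln q) * q powr (- (\<epsilon> * n))" (is ?small)
proof -
  define w where "w = (\<lambda>y. q ^ n * pmf W y)"
  define S where "S = (\<lambda>C. vec_mean n (\<lambda>y. coset_avg C w y powr \<alpha>))"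
  let ?E = "measure_pmf.expectation (pmf_of_set (linear_codes n k))"
  interpret vec_density n w \<alpha> q
  proof
    show "vec_mean n w = 1"
      using sum_pmf_eq_1[OF finite_carrier_vec W]
      by (simp add: vec_mean_def w_def q_def sum_distrib_left[symmetric])
  qed (use alpha in \<open>simp_all add: w_def q_def\<close>)
  have q: "q > 1" using q_ge_2 by simp
  let ?H = "renyi_entropy q \<alpha> (carrier_vec n) W"
  let ?M = "\<Sum>y\<in>carrier_vec n. pmf W y powr \<alpha>"
  let ?A = "vec_mean n (\<lambda>y. w y powr \<alpha>)"
  define Q where "Q = q powr (k - \<epsilon> * n)"
  have A: "?A = q powr ((\<alpha> - 1) * n) * ?M"
  proof -
    have "?A = (\<Sum>y\<in>carrier_vec n. (q ^ n) powr \<alpha> * pmf W y powr \<alpha>) / q ^ n"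
      using q by (simp add: vec_mean_def w_def powr_mult q_def)
    also have "\<dots> = (q ^ n) powr \<alpha> / q ^ n * ?M"
      by (simp add: sum_distrib_left sum_divide_distrib)
    also have "(q ^ n) powr \<alpha> / q ^ n = (q ^ n) powr (\<alpha> - 1)"
      using q by (simp add: powr_diff)
    also have "\<dots> = q powr ((\<alpha> - 1) * n)"
      using q by (simp add: powr_realpow[symmetric] powr_powr mult.commute)
    finally show ?thesis .
  qed
  have A1: "?A \<ge> 1" by (rule power_moment_ge_1)
  \<comment> \<open>Positivity is needed to split the logarithm of the product in the next
    step.\<close>
  then have M: "?M > 0" unfolding A using q
    by (smt (verit) mult_nonneg_nonpos powr_ge_zero)
  have "log q ?A = (\<alpha> - 1) * n + log q ?M"
    unfolding A using q M by (simp add: log_mult)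
  also have "log q ?M = - (\<alpha> - 1) * ?H"
    using alpha by (simp add: renyi_entropy_def field_simps)
  finally have logA: "log q ?A = (\<alpha> - 1) * (n - ?H)" by (simp add: algebra_simps)
  have "(1 - ?H / n + \<epsilon>) * n \<le> k / n * n"
    using rate by (intro mult_right_mono) auto
  then have "n - ?H + \<epsilon> * n \<le> k"
    using n by (simp add: algebra_simps)
  then have "log q ?A \<le> (\<alpha> - 1) * (k - \<epsilon> * n)"
    unfolding logA using alpha by (intro mult_left_mono) auto
  then have "q powr (log q ?A) \<le> q powr ((\<alpha> - 1) * (k - \<epsilon> * n))"
    using q by (intro powr_mono) auto
  then have AQ: "?A \<le> Q powr (\<alpha> - 1)"
    using q A1 by (simp add: Q_def powr_powr mult.commute)
  have Qk: "Q / q ^ k = q powr (- (\<epsilon> * n))"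
    using q by (simp add: Q_def powr_realpow[symmetric] powr_diff[symmetric])
  have "Q \<le> q powr real k"
    unfolding Q_def using q eps by (intro powr_mono) auto
  then have Qle: "Q \<le> q ^ k" using q by (simp add: powr_realpow)
  have ES: "?E S \<le> 1 + K * q powr (- (\<epsilon> * n))"
    using E_power_moment_le[OF _ AQ k Qle] q unfolding S_def K_def Qk by (simp add: Q_def)
  have S1: "S C \<ge> 1" if "linear_subspace n C" for C
    unfolding S_def using that by (rule power_moment_coset_avg_ge_1)
  have D: "smoothing_divergence \<alpha> n W C = 1 / (\<alpha> - 1) * log q (S C)" if "linear_subspace n C" for C
    unfolding S_def w_def q_def using smoothing_divergence_eq[OF that W] by simp
  have "?E (\<lambda>C. q powr ((\<alpha> - 1) * smoothing_divergence \<alpha> n W C)) \<le> ?E S"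
  proof (intro expectation_linear_codes_mono k)
    fix C :: "'a vec set" assume C: "linear_subspace n C"
    show "q powr ((\<alpha> - 1) * smoothing_divergence \<alpha> n W C) \<le> S C"
      using D[OF C] S1[OF C] alpha q by simp
  qed
  with ES show ?bound by simp
  have "?E (\<lambda>_ :: 'a vec set. 0) \<le> ?E (smoothing_divergence \<alpha> n W)"
  proof (intro expectation_linear_codes_mono k)
    fix C :: "'a vec set" assume C: "linear_subspace n C"
    show "0 \<le> smoothing_divergence \<alpha> n W C"
      using D[OF C] S1[OF C] alpha q by simp
  qed
  then show ?nonneg by simp
  have "?E (smoothing_divergence \<alpha> n W) \<le> ?E (\<lambda>C. (S C - 1) / ((\<alpha> - 1) * ln q))"
  proof (intro expectation_linear_codes_mono k)
    fix C :: "'a vec set" assume C: "linear_subspace n C"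
    \<comment> \<open>The inequality \<open>ln x \<le> x - 1\<close> makes the bound linear in
      \<open>S C\<close>, so it can be averaged over codes.\<close>
    have "ln (S C) / ((\<alpha> - 1) * ln q) \<le> (S C - 1) / ((\<alpha> - 1) * ln q)"
      using S1[OF C] alpha q by (intro divide_right_mono ln_le_minus_one) auto
    then show "smoothing_divergence \<alpha> n W C \<le> (S C - 1) / ((\<alpha> - 1) * ln q)"
      by (simp add: D[OF C] log_def)
  qed
  also have "\<dots> = (?E S - 1) / ((\<alpha> - 1) * ln q)"
    by (simp add: integrable_linear_codes[OF k])
  also have "\<dots> \<le> K * q powr (- (\<epsilon> * n)) / ((\<alpha> - 1) * ln q)"
    using ES alpha q by (intro divide_right_mono) auto
  finally show ?small by simp
qed

text \<open>The constant is built from \<open>\<alpha>\<close> and \<open>q\<close> alone and is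
  chosen before the noise and the dimensions, so it is uniform in \<open>n\<close>. The limit
  follows by squeezing the expected divergence between 0 and a multiple of
  \<open>q powr (- (\<epsilon> * n))\<close>.\<close>

theorem theorem3:
  fixes q :: nat and \<alpha> \<epsilon> :: real
  assumes "q = CARD('a::{field,finite})" and "\<alpha> > 2" and "\<epsilon> > 0"
  shows "\<exists>K::real. \<forall>(W :: nat \<Rightarrow> 'a vec pmf) (k :: nat \<Rightarrow> nat).
    (\<forall>n\<ge>1. set_pmf (W n) \<subseteq> carrier_vec n \<and> 1 \<le> k n \<and> k n \<le> n \<and>
       real (k n) / real n
         \<ge> 1 - renyi_entropy (real q) \<alpha> (carrier_vec n) (W n) / real n + \<epsilon>)
    \<longrightarrow>
    (\<lambda>n. measure_pmf.expectation (pmf_of_set (linear_codes n (k n)))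
           (\<lambda>C. smoothing_divergence \<alpha> n (W n) C)) \<longlonglongrightarrow> 0 \<and>
    (\<forall>n\<ge>1. measure_pmf.expectation (pmf_of_set (linear_codes n (k n)))
           (\<lambda>C. real q powr ((\<alpha> - 1) * smoothing_divergence \<alpha> n (W n) C))
         \<le> 1 + K * real q powr (- (\<epsilon> * real n)))"
proof (intro exI allI impI)
  define K where "K = \<alpha> * (\<alpha> - 1) * 2 powr \<alpha> * (1 + smoothing_const \<alpha> (real q))"
  fix W :: "nat \<Rightarrow> 'a vec pmf" and k :: "nat \<Rightarrow> nat"
  assume A: "\<forall>n\<ge>1. set_pmf (W n) \<subseteq> carrier_vec n \<and> 1 \<le> k n \<and> k n \<le> n \<and>
       real (k n) / real n \<ge> 1 - renyi_entropy (real q) \<alpha> (carrier_vec n) (W n) / real n + \<epsilon>"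
  let ?E = "\<lambda>n. measure_pmf.expectation (pmf_of_set (linear_codes n (k n)))
     (\<lambda>C. smoothing_divergence \<alpha> n (W n) C)"
  let ?c = "K / ((\<alpha> - 1) * ln (real q))"
  note b = smoothing_bounds[where 'a='a, folded assms(1), OF assms(2,3), folded K_def]
  have q: "real q > 1" using card_field_gt_1[where 'a='a] assms(1) by simp
  have "(\<lambda>n. ?c * (real q powr (- \<epsilon>)) ^ n) \<longlonglongrightarrow> ?c * 0"
    using q assms(3) powr_less_cancel_iff[of "real q" "- \<epsilon>" 0]
    by (intro tendsto_mult tendsto_const LIMSEQ_realpow_zero) auto
  moreover have "(real q powr (- \<epsilon>)) ^ n = real q powr (- (\<epsilon> * real n))" for n
    using q by (simp add: powr_realpow[symmetric] powr_powr)
  ultimately have lim: "(\<lambda>n. ?c * real q powr (- (\<epsilon> * real n))) \<longlonglongrightarrow> 0" by simp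
  have "?E \<longlonglongrightarrow> 0"
  proof (rule tendsto_sandwich[OF _ _ tendsto_const lim])
    show "\<forall>\<^sub>F n in sequentially. 0 \<le> ?E n"
      \<comment> \<open>The assumptions speak of \<open>n \<ge> 1\<close> only, which suffices for a
        limit.\<close>
      using A b(2) by (intro eventually_sequentiallyI[of 1]) auto
    show "\<forall>\<^sub>F n in sequentially. ?E n \<le> ?c * real q powr (- (\<epsilon> * real n))"
      using A b(3) by (intro eventually_sequentiallyI[of 1]) auto
  qed
  moreover have "\<forall>n\<ge>1. measure_pmf.expectation (pmf_of_set (linear_codes n (k n)))
           (\<lambda>C. real q powr ((\<alpha> - 1) * smoothing_divergence \<alpha> n (W n) C))
         \<le> 1 + K * real q powr (- (\<epsilon> * real n))"
    using A b(1) by auto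
  ultimately show "?E \<longlonglongrightarrow> 0 \<and> (\<forall>n\<ge>1. measure_pmf.expectation (pmf_of_set (linear_codes n (k n)))
           (\<lambda>C. real q powr ((\<alpha> - 1) * smoothing_divergence \<alpha> n (W n) C))
         \<le> 1 + K * real q powr (- (\<epsilon> * real n)))" ..
qed

end
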